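(* Let $X$ be a separable infinite dimensional Banach space and let $\mathcal N$ be the operator norm closure in $L(X)$ of the set of finite rank nilpotent operators. Then the set of $T\in\mathcal N$ for which $T$ is supercyclic and $I+T$ is hypercyclic is a dense $G_\delta$ subset of the complete metric space $\mathcal N$. If additionally $X'$ is separable, then the set of $T\in\mathcal N$ for which $T$ and $T'$ are supercyclic and $I+T$ and $I+T'$ are hypercyclic is a dense $G_\delta$ subset of $\mathcal N$.
   Context: Spaces are over $\mathbb K$, which is $\mathbb R$ or $\mathbb C$; $\mathbb Z_+=\{0,1,2,\dots\}$. $L(X)$ is the Banach space of bounded linear operators on $X$ with the operator norm; $\mathcal N$ carries the operator norm metric. $X'$ is the dual Banach space, and $T':X'\to X'$, $(T'f)(x)=f(Tx)$. A bounded operator $S$ on a Banach space $Z$ is hypercyclic if $\{S^nz:n\in\mathbb Z_+\}$ is dense in $Z$ for some $z\in Z$, and supercyclic if $\{\lambda S^nz:\lambda\in\mathbb K,\ n\in\mathbb Z_+\}$ is dense in $Z$ for some $z\in Z$. *)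

theory Defs
  imports "HOL-Analysis.Analysis"
begin

text \<open>The scalar field \<open>\<K>\<close>: a normed field that is isometrically isomorphic, over the reals,
  to \<open>\<real>\<close> or to \<open>\<complex>\<close>. The parent \<^class>\<open>banach\<close> only makes completeness available to the
  type system; it follows from the axiom.\<close>

class real_or_complex = real_normed_field + banach +
  assumes real_or_complex_embedding:
    "\<exists>\<phi> :: 'a \<Rightarrow> complex.
       (\<forall>x y. \<phi> (x + y) = \<phi> x + \<phi> y) \<and>
       (\<forall>x y. \<phi> (x * y) = \<phi> x * \<phi> y) \<and>
       (\<forall>r x. \<phi> (r *\<^sub>R x) = r *\<^sub>R \<phi> x) \<and>
       (\<forall>x. norm (\<phi> x) = norm x) \<and>
       (range \<phi> = \<real> \<or> range \<phi> = UNIV)"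

instance real :: real_or_complex
  by standard (rule exI[where x = complex_of_real], auto simp: Reals_def scaleR_conv_of_real)

instance complex :: real_or_complex
  by standard (rule exI[where x = "\<lambda>z. z"], auto)

text \<open>A Banach space over \<open>\<K>\<close>. The type class \<^class>\<open>banach\<close> supplies the norm, completeness and
  the underlying real structure, with which the scalar multiplication over \<open>\<K>\<close> has to agree.\<close>

locale banach_space_over = vector_space smul
  for smul :: "'k::real_or_complex \<Rightarrow> 'a::banach \<Rightarrow> 'a" +
  assumes norm_scale: "norm (smul c x) = norm c * norm x"
    and scale_of_real: "smul (of_real r) x = r *\<^sub>R x"

lemma banach_space_over_scaleR: "banach_space_over ((*\<^sub>R) :: real \<Rightarrow> 'a::banach \<Rightarrow> 'a)"
  by unfold_locales (auto simp: algebra_simps)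

lemma banach_space_over_mult: "banach_space_over ((*) :: 'k::real_or_complex \<Rightarrow> 'k \<Rightarrow> 'k)"
  by unfold_locales (auto simp: algebra_simps norm_mult scaleR_conv_of_real)

definition infinite_dimensional :: "('k::real_or_complex \<Rightarrow> 'a::banach \<Rightarrow> 'a) \<Rightarrow> bool" where
  "infinite_dimensional smul \<longleftrightarrow> \<not> (\<exists>B. finite B \<and> module.span smul B = UNIV)"

text \<open>\<open>L(X)\<close>. The elements of the type \<open>'a \<Rightarrow>\<^sub>L 'a\<close> are the bounded real-linear maps, so
  \<open>\<K>\<close>-homogeneity has to be imposed; the norm of that type is the operator norm.\<close>

definition operators :: "('k::real_or_complex \<Rightarrow> 'a::banach \<Rightarrow> 'a) \<Rightarrow> ('a \<Rightarrow>\<^sub>L 'a) set" where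
  "operators smul = {T. \<forall>c x. blinfun_apply T (smul c x) = smul c (blinfun_apply T x)}"

definition finite_rank :: "('k::real_or_complex \<Rightarrow> 'a::banach \<Rightarrow> 'a) \<Rightarrow> ('a \<Rightarrow>\<^sub>L 'a) \<Rightarrow> bool" where
  "finite_rank smul T \<longleftrightarrow> (\<exists>B. finite B \<and> range (blinfun_apply T) \<subseteq> module.span smul B)"

definition nilpotent :: "('a::banach \<Rightarrow>\<^sub>L 'a) \<Rightarrow> bool" where
  "nilpotent T \<longleftrightarrow> (\<exists>n. \<forall>x. (blinfun_apply T ^^ n) x = 0)"

definition nilpotent_closure :: "('k::real_or_complex \<Rightarrow> 'a::banach \<Rightarrow> 'a) \<Rightarrow> ('a \<Rightarrow>\<^sub>L 'a) set" where
  "nilpotent_closure smul =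
     top_of_set (operators smul) closure_of {T \<in> operators smul. finite_rank smul T \<and> nilpotent T}"

text \<open>The dual \<open>X'\<close>, a set of bounded real-linear maps into \<open>\<K>\<close> for the same reason as above, with its
  scalar multiplication \<open>(c f)(x) = c * f x\<close>.\<close>

definition dual :: "('k::real_or_complex \<Rightarrow> 'a::banach \<Rightarrow> 'a) \<Rightarrow> ('a \<Rightarrow>\<^sub>L 'k) set" where
  "dual smul = {f. \<forall>c x. blinfun_apply f (smul c x) = c * blinfun_apply f x}"

definition dual_scale :: "'k::real_or_complex \<Rightarrow> ('a::banach \<Rightarrow>\<^sub>L 'k) \<Rightarrow> ('a \<Rightarrow>\<^sub>L 'k)" where
  "dual_scale c f = blinfun_mult_right c o\<^sub>L f"

lemma dual_scale_apply: "blinfun_apply (dual_scale c f) x = c * blinfun_apply f x"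
  by (simp add: dual_scale_def)

definition dual_map :: "('a::banach \<Rightarrow>\<^sub>L 'a) \<Rightarrow> ('a \<Rightarrow>\<^sub>L 'k::real_or_complex) \<Rightarrow> ('a \<Rightarrow>\<^sub>L 'k)" where
  "dual_map T f = f o\<^sub>L T"

text \<open>Both notions are relative to a carrier \<open>Z\<close> that \<open>S\<close> maps to itself, because \<open>X'\<close> is not a
  whole type. Density is density in \<open>Z\<close>.\<close>

definition hypercyclic :: "'b::real_normed_vector set \<Rightarrow> ('b \<Rightarrow> 'b) \<Rightarrow> bool" where
  "hypercyclic Z S \<longleftrightarrow> (\<exists>z\<in>Z. top_of_set Z closure_of {(S ^^ n) z | n. True} = Z)"

definition supercyclic ::
    "('k::real_or_complex \<Rightarrow> 'b::real_normed_vector \<Rightarrow> 'b) \<Rightarrow> 'b set \<Rightarrow> ('b \<Rightarrow> 'b) \<Rightarrow> bool" where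
  "supercyclic smul Z S \<longleftrightarrow>
     (\<exists>z\<in>Z. top_of_set Z closure_of {smul c ((S ^^ n) z) | c n. True} = Z)"

definition dense_gdelta_in :: "'b topology \<Rightarrow> 'b set \<Rightarrow> bool" where
  "dense_gdelta_in X S \<longleftrightarrow> gdelta_in X S \<and> X closure_of S = topspace X"

end

theory Submission
  imports Defs
begin

text \<open>Supercyclicity and hypercyclicity are equivalent to countably many open transitivity conditions on
  \<open>T\<close>, one for each pair \<open>(u, v)\<close> from a countable dense set and each precision, so by Baire it suffices
  to satisfy a single such condition near a given finite rank nilpotent \<open>T\<^sub>0\<close>. By Hahn--Banach there is a
  biorthogonal system \<open>(e\<^sub>i, f\<^sub>i)\<close> with \<open>e\<^sub>i\<close> in the kernel of \<open>T\<^sub>0\<close> and \<open>f\<^sub>i\<close> vanishing on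
  its range and on \<open>u\<close>, \<open>v\<close>. Adding to \<open>T\<^sub>0\<close> a small multiple of a backward shift along the \<open>e\<^sub>i\<close> that
  ends in \<open>u\<close> and in \<open>v\<close> gives a finite rank nilpotent \<open>T\<close> with \<open>u = T\<^sup>p g\<close>, \<open>v = T\<^sup>p h\<close> and
  \<open>T\<^sup>p u = T\<^sup>p v = 0\<close>. Then \<open>w = u + t h\<close> satisfies \<open>t\<^sup>-\<^sup>1 T\<^sup>p w = v\<close> for every \<open>t \<noteq> 0\<close>. For \<open>I + T\<close>, the space
  spanned by \<open>g, T g, \<dots>\<close> is a quotient of the polynomials of degree less than \<open>2p\<close>, with \<open>T\<close> acting as
  the forward difference and \<open>I + T\<close> as the translation by one, and suitable small vectors are given by
  explicit polynomials. The dual statement is obtained in the same way from a shift along the \<open>f\<^sub>i\<close>.\<close>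

section \<open>The Hahn--Banach theorem\<close>

definition sublinear :: "('a::real_vector \<Rightarrow> real) \<Rightarrow> bool" where
  "sublinear p \<longleftrightarrow> (\<forall>x y. p (x + y) \<le> p x + p y) \<and> (\<forall>x c. 0 < c \<longrightarrow> p (c *\<^sub>R x) \<le> c * p x)"

lemma sublinear_add: "sublinear p \<Longrightarrow> p (x + y) \<le> p x + p y"
  by (simp add: sublinear_def)

lemma sublinear_scaleR:
  assumes "sublinear p" "0 < c"
  shows "p (c *\<^sub>R x) = c * p x"
proof (rule antisym)
  show "p (c *\<^sub>R x) \<le> c * p x"
    using assms by (simp add: sublinear_def)
  have "p (inverse c *\<^sub>R (c *\<^sub>R x)) \<le> inverse c * p (c *\<^sub>R x)"
    using assms unfolding sublinear_def by (metis positive_imp_inverse_positive)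
  with assms show "c * p x \<le> p (c *\<^sub>R x)"
    by (simp add: field_simps)
qed

lemma sublinear_zero: "sublinear p \<Longrightarrow> p 0 = 0"
  using sublinear_scaleR[of p 2 0] by simp

lemma sublinear_lower_bound: "sublinear p \<Longrightarrow> - p (- x) \<le> p x"
  using sublinear_add[of p x "- x"] by (simp add: sublinear_zero)

definition tilt :: "('a::real_vector \<Rightarrow> real) \<Rightarrow> 'a \<Rightarrow> 'a \<Rightarrow> real" where
  "tilt p y x = (INF t\<in>{0..}. p (x + t *\<^sub>R y) - t * p y)"

lemma tilt_lower_bound:
  assumes "sublinear p" "0 \<le> t"
  shows "- p (- x) \<le> p (x + t *\<^sub>R y) - t * p y"
proof -
  have "t * p y = p (t *\<^sub>R y)"
    using assms by (cases "t = 0") (auto simp: sublinear_zero sublinear_scaleR)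
  also have "\<dots> \<le> p (x + t *\<^sub>R y) + p (- x)"
    using sublinear_add[OF assms(1), of "x + t *\<^sub>R y" "- x"] by simp
  finally show ?thesis by simp
qed

lemma tilt_le:
  assumes "sublinear p" "0 \<le> t"
  shows "tilt p y x \<le> p (x + t *\<^sub>R y) - t * p y"
  unfolding tilt_def
  by (rule cINF_lower) (use assms tilt_lower_bound in \<open>auto intro!: bdd_belowI2\<close>)

lemma tilt_greatest:
  assumes "\<And>t. 0 \<le> t \<Longrightarrow> b \<le> p (x + t *\<^sub>R y) - t * p y"
  shows "b \<le> tilt p y x"
  unfolding tilt_def by (rule cINF_greatest) (use assms in auto)

lemma sublinear_tilt:
  assumes p: "sublinear p"
  shows "sublinear (tilt p y)"
  unfolding sublinear_def
proof (intro conjI allI impI)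
  fix x z
  have *: "tilt p y (x + z) - (p (x + s *\<^sub>R y) - s * p y) \<le> p (z + t *\<^sub>R y) - t * p y"
    if "0 \<le> s" "0 \<le> t" for s t
    using tilt_le[OF p, of "s + t" y "x + z"] sublinear_add[OF p, of "x + s *\<^sub>R y" "z + t *\<^sub>R y"] that
    by (simp add: algebra_simps)
  have "tilt p y (x + z) - (p (x + s *\<^sub>R y) - s * p y) \<le> tilt p y z" if "0 \<le> s" for s
    by (rule tilt_greatest) (use * that in auto)
  then have "tilt p y (x + z) - tilt p y z \<le> tilt p y x"
    by (intro tilt_greatest) (simp add: algebra_simps)
  then show "tilt p y (x + z) \<le> tilt p y x + tilt p y z"
    by simp
next
  fix x and c :: real
  assume c: "0 < c"
  have "tilt p y (c *\<^sub>R x) / c \<le> p (x + t *\<^sub>R y) - t * p y" if "0 \<le> t" for t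
  proof -
    have "tilt p y (c *\<^sub>R x) \<le> p (c *\<^sub>R (x + t *\<^sub>R y)) - c * t * p y"
      using tilt_le[OF p, of "c * t" y "c *\<^sub>R x"] that c by (simp add: scaleR_add_right)
    then show ?thesis
      using c unfolding sublinear_scaleR[OF p c] by (simp add: field_simps)
  qed
  then have "tilt p y (c *\<^sub>R x) / c \<le> tilt p y x"
    by (rule tilt_greatest)
  then show "tilt p y (c *\<^sub>R x) \<le> c * tilt p y x"
    using c by (simp add: field_simps)
qed

lemma sublinear_minimal_linear:
  assumes m: "sublinear m" and min: "\<And>q. sublinear q \<Longrightarrow> q \<le> m \<Longrightarrow> q = m"
  shows "linear m"
proof -
  have "tilt m y = m" for y
    by (rule min[OF sublinear_tilt[OF m]])
       (use tilt_le[OF m, of 0 y] in \<open>simp add: le_fun_def\<close>)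
  then have "m x \<le> m (x + y) - m y" for x y
    using tilt_le[OF m, of 1 y x] by simp
  then have add: "m (x + y) = m x + m y" for x y
    using sublinear_add[OF m, of x y] by (smt (verit))
  then have minus: "m (- x) = - m x" for x
    using add[of x "- x"] sublinear_zero[OF m] by simp
  have "m (c *\<^sub>R x) = c * m x" for c x
  proof -
    consider "c = 0" | "0 < c" | "c < 0" by linarith
    then show ?thesis
    proof cases
      case 3
      then show ?thesis
        using sublinear_scaleR[OF m, of "- c" x] minus[of "c *\<^sub>R x"] by simp
    qed (auto simp: sublinear_zero[OF m] sublinear_scaleR[OF m])
  qed
  with add show ?thesis
    by (intro linearI) auto
qed

lemma ex_linear_below_sublinear:
  assumes p: "sublinear (p :: 'a::real_vector \<Rightarrow> real)"
  shows "\<exists>u. linear u \<and> u \<le> p"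
proof -
  define A where "A = {q. sublinear q \<and> q \<le> p}"
  define P where "P f g \<longleftrightarrow> g \<le> f" for f g :: "'a \<Rightarrow> real"
  have "\<exists>m\<in>A. \<forall>a\<in>A. P m a \<longrightarrow> a = m"
  proof (rule predicate_Zorn)
    show "partial_order_on A (relation_of P A)"
      by (rule partial_order_on_relation_ofI) (auto simp: P_def)
  next
    fix C assume C: "C \<in> Chains (relation_of P A)"
    then have chain: "f \<le> g \<or> g \<le> f" if "f \<in> C" "g \<in> C" for f g
      using that by (auto simp: Chains_def relation_of_def P_def)
    have CA: "C \<subseteq> A"
      using C by (auto simp: Chains_def relation_of_def)
    show "\<exists>u\<in>A. \<forall>a\<in>C. P a u"
    proof (cases "C = {}")
      case True
      then show ?thesis using p by (auto simp: A_def)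
    next
      case False
      define u where "u x = (INF q\<in>C. q x)" for x
      have sub: "sublinear q" "q \<le> p" if "q \<in> C" for q
        using CA that by (auto simp: A_def)
      have "- p (- x) \<le> q x" if "q \<in> C" for q x
        using sublinear_lower_bound[OF sub(1)[OF that], of x] sub(2)[OF that]
        by (auto simp: le_fun_def intro: order_trans[rotated])
      then have lower: "u x \<le> q x" if "q \<in> C" for q x
        unfolding u_def by (intro cINF_lower bdd_belowI2) (use that in auto)
      have greatest: "b \<le> u x" if "\<And>q. q \<in> C \<Longrightarrow> b \<le> q x" for b x
        unfolding u_def by (rule cINF_greatest) (use False that in auto)
      have "sublinear u"
        unfolding sublinear_def
      proof (intro conjI allI impI)
        fix x y
        have *: "u (x + y) - q x \<le> r y" if "q \<in> C" "r \<in> C" for q r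
        proof (cases "q \<le> r")
          case True
          then show ?thesis
            using lower[OF that(1), of "x + y"] sublinear_add[OF sub(1)[OF that(1)], of x y]
            by (auto dest: le_funD[of _ _ y])
        next
          case False
          then have "r \<le> q" using chain that by blast
          then show ?thesis
            using lower[OF that(2), of "x + y"] sublinear_add[OF sub(1)[OF that(2)], of x y]
            by (auto dest: le_funD[of _ _ x])
        qed
        have "u (x + y) - q x \<le> u y" if "q \<in> C" for q
          by (rule greatest) (use * that in auto)
        then have "u (x + y) - u y \<le> u x"
          by (intro greatest) (simp add: algebra_simps)
        then show "u (x + y) \<le> u x + u y" by simp
      next
        fix x and c :: real
        assume c: "0 < c"
        have "u (c *\<^sub>R x) / c \<le> q x" if "q \<in> C" for q
          using lower[OF that, of "c *\<^sub>R x"] sublinear_scaleR[OF sub(1)[OF that] c, of x] c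
          by (simp add: field_simps)
        then have "u (c *\<^sub>R x) / c \<le> u x" by (rule greatest)
        then show "u (c *\<^sub>R x) \<le> c * u x" using c by (simp add: field_simps)
      qed
      moreover obtain q where "q \<in> C" using False by blast
      then have "u \<le> p"
        using lower[of q] sub(2)[of q] by (auto simp: le_fun_def intro: order_trans)
      ultimately show ?thesis
        using lower by (auto simp: A_def P_def le_fun_def)
    qed
  qed
  then obtain m where m: "m \<in> A" and min: "\<And>a. a \<in> A \<Longrightarrow> a \<le> m \<Longrightarrow> a = m"
    by (auto simp: P_def)
  have "linear m"
    by (rule sublinear_minimal_linear) (use m min in \<open>auto simp: A_def\<close>)
  with m show ?thesis by (auto simp: A_def)
qed

text \<open>Tilting by \<open>e\<close> first forces \<open>u (- e) \<le> - p e\<close>, hence equality at \<open>e\<close>.\<close>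

theorem hahn_banach_sublinear:
  assumes p: "sublinear (p :: 'a::real_vector \<Rightarrow> real)"
  shows "\<exists>u. linear u \<and> u \<le> p \<and> u e = p e"
proof -
  obtain u where u: "linear u" "u \<le> tilt p e"
    using ex_linear_below_sublinear[OF sublinear_tilt[OF p]] by blast
  have le: "u \<le> p"
    using u(2) tilt_le[OF p, of 0 e] by (auto simp: le_fun_def intro: order_trans)
  have "u (- e) \<le> - p e"
    using le_funD[OF u(2), of "- e"] tilt_le[OF p, of 1 e "- e"] by (simp add: sublinear_zero[OF p])
  then have "u e = p e"
    using le_funD[OF le, of e] by (simp add: linear_neg[OF u(1)])
  with u(1) le show ?thesis by blast
qed

lemma sublinear_infdist:
  fixes S :: "'a::real_normed_vector set"
  assumes S: "subspace S"
  shows "sublinear (\<lambda>x. infdist x S)"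
proof -
  have ne: "S \<noteq> {}" using subspace_0[OF S] by blast
  have greatest: "b \<le> infdist x S" if "\<And>s. s \<in> S \<Longrightarrow> b \<le> dist x s" for b x
    unfolding infdist_notempty[OF ne] by (rule cINF_greatest) (use ne that in auto)
  show ?thesis
    unfolding sublinear_def
  proof (intro conjI allI impI)
    fix x y
    have *: "infdist (x + y) S - dist x s \<le> dist y t" if "s \<in> S" "t \<in> S" for s t
      using infdist_le[OF subspace_add[OF S that], of "x + y"]
        norm_triangle_ineq[of "x - s" "y - t"] by (simp add: dist_norm algebra_simps)
    have "infdist (x + y) S - dist x s \<le> infdist y S" if "s \<in> S" for s
      by (rule greatest) (use * that in auto)
    then have "infdist (x + y) S - infdist y S \<le> infdist x S"
      by (intro greatest) (simp add: algebra_simps)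
    then show "infdist (x + y) S \<le> infdist x S + infdist y S" by simp
  next
    fix x and c :: real
    assume c: "0 < c"
    have "infdist (c *\<^sub>R x) S / c \<le> dist x s" if "s \<in> S" for s
      using infdist_le[OF subspace_scale[OF S that, of c], of "c *\<^sub>R x"] c
      by (simp add: dist_norm flip: scaleR_diff_right) (simp add: field_simps)
    then have "infdist (c *\<^sub>R x) S / c \<le> infdist x S" by (rule greatest)
    then show "infdist (c *\<^sub>R x) S \<le> c * infdist x S" using c by (simp add: field_simps)
  qed
qed

lemma ex_bounded_linear_separating:
  fixes S :: "'a::real_normed_vector set"
  assumes S: "subspace S" "closed S" and e: "e \<notin> S"
  shows "\<exists>u :: 'a \<Rightarrow> real. bounded_linear u \<and> (\<forall>x\<in>S. u x = 0) \<and> u e \<noteq> 0"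
proof -
  obtain u where u: "linear u" "u \<le> (\<lambda>x. infdist x S)" "u e = infdist e S"
    using hahn_banach_sublinear[OF sublinear_infdist[OF S(1)]] by blast
  have le: "u x \<le> infdist x S" for x using le_funD[OF u(2)] .
  have "\<bar>u x\<bar> \<le> norm x" for x
    using le[of x] le[of "- x"] infdist_le[OF subspace_0[OF S(1)], of x]
      infdist_le[OF subspace_0[OF S(1)], of "- x"]
    by (simp add: linear_neg[OF u(1)])
  then have "bounded_linear u"
    using u(1) by (intro bounded_linear_intro[where K = 1]) (auto simp: linear_add linear_scale)
  moreover have "u x = 0" if "x \<in> S" for x
    using le[of x] le[of "- x"] that subspace_neg[OF S(1) that] by (simp add: linear_neg[OF u(1)])
  moreover have "u e \<noteq> 0"
  proof -
    have "S \<noteq> {}" using subspace_0[OF S(1)] by blast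
    then show ?thesis using u(3) infdist_pos_not_in_closed[OF S(2) _ e] by simp
  qed
  ultimately show ?thesis by blast
qed

section \<open>Orbits of unipotent operators\<close>

lemma blinfun_funpow_add:
  fixes B :: "'b::real_normed_vector \<Rightarrow>\<^sub>L 'b"
  shows "(blinfun_apply B ^^ n) (x + y) = (blinfun_apply B ^^ n) x + (blinfun_apply B ^^ n) y"
  by (induction n arbitrary: x y) (simp_all add: blinfun.add_right)

lemma blinfun_funpow_scaleR:
  fixes B :: "'b::real_normed_vector \<Rightarrow>\<^sub>L 'b"
  shows "(blinfun_apply B ^^ n) (c *\<^sub>R x) = c *\<^sub>R (blinfun_apply B ^^ n) x"
  by (induction n) (simp_all add: blinfun.scaleR_right)

lemma blinfun_funpow_zero:
  fixes B :: "'b::real_normed_vector \<Rightarrow>\<^sub>L 'b"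
  shows "(blinfun_apply B ^^ n) 0 = 0"
  by (induction n) simp_all

definition fdiff :: "(real \<Rightarrow> real) \<Rightarrow> real \<Rightarrow> real" where
  "fdiff f t = f (t + 1) - f t"

lemma fdiff_funpow_zero: "(fdiff ^^ k) (\<lambda>_. 0) = (\<lambda>_. 0)"
  by (induction k) (simp_all add: fdiff_def fun_eq_iff)

lemma fdiff_funpow_shift: "(fdiff ^^ k) (\<lambda>t. f (t + c)) = (\<lambda>t. (fdiff ^^ k) f (t + c))"
  by (induction k) (simp_all add: fdiff_def fun_eq_iff add_ac)

lemma fdiff_funpow_add: "(fdiff ^^ k) (\<lambda>t. f t + g t) = (\<lambda>t. (fdiff ^^ k) f t + (fdiff ^^ k) g t)"
  by (induction k) (simp_all add: fdiff_def fun_eq_iff)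

lemma fdiff_funpow_mult: "(fdiff ^^ k) (\<lambda>t. c * f t) = (\<lambda>t. c * (fdiff ^^ k) f t)"
  by (induction k) (simp_all add: fdiff_def fun_eq_iff algebra_simps)

lemma fdiff_funpow_affine_mult:
  assumes "(fdiff ^^ k) f = (\<lambda>_. 0)"
  shows "(fdiff ^^ Suc k) (\<lambda>t. (a * t + b) * f t) = (\<lambda>_. 0)"
  using assms
proof (induction k arbitrary: f)
  case 0
  then show ?case by (simp add: fdiff_def fun_eq_iff)
next
  case (Suc k)
  have "fdiff (\<lambda>t. (a * t + b) * f t) = (\<lambda>t. (a * t + b) * fdiff f t + a * f (t + 1))"
    by (simp add: fdiff_def fun_eq_iff algebra_simps)
  then have "(fdiff ^^ Suc (Suc k)) (\<lambda>t. (a * t + b) * f t)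
      = (\<lambda>t. (fdiff ^^ Suc k) (\<lambda>t. (a * t + b) * fdiff f t) t + a * (fdiff ^^ Suc k) f (t + 1))"
    by (simp only: funpow_Suc_right[of "Suc k"] o_apply fdiff_funpow_add fdiff_funpow_mult fdiff_funpow_shift)
  with Suc show ?case
    by (simp add: funpow_Suc_right del: funpow.simps)
qed

lemma fdiff_funpow_affine_power_mult:
  assumes "(fdiff ^^ k) f = (\<lambda>_. 0)"
  shows "(fdiff ^^ (k + m)) (\<lambda>t. (a * t + b) ^ m * f t) = (\<lambda>_. 0)"
proof (induction m)
  case (Suc m)
  then show ?case
    using fdiff_funpow_affine_mult[OF Suc, of a b] by (simp add: mult.assoc)
qed (use assms in simp)

lemma fdiff_funpow_gbinomial:
  "j \<le> k \<Longrightarrow> (fdiff ^^ j) (\<lambda>t. t gchoose k) = (\<lambda>t. t gchoose (k - j))"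
proof (induction j)
  case (Suc j)
  then have "k - j = Suc (k - Suc j)" by simp
  with Suc show ?case by (simp add: fdiff_def fun_eq_iff gbinomial_Suc_Suc)
qed simp

lemma fdiff_funpow_gbinomial_vanish: "(fdiff ^^ Suc k) (\<lambda>t. t gchoose k) = (\<lambda>_. 0)"
  using fdiff_funpow_gbinomial[of k k] by (simp add: fdiff_def fun_eq_iff)

lemma tendsto_fdiff_funpow:
  assumes "\<And>k :: nat. (\<lambda>n. F n (real k)) \<longlonglongrightarrow> f (real k)"
  shows "(\<lambda>n. (fdiff ^^ j) (F n) (real k)) \<longlonglongrightarrow> (fdiff ^^ j) f (real k)"
proof (induction j arbitrary: k)
  case (Suc j)
  show ?case
    using tendsto_diff[OF Suc[of "Suc k"] Suc[of k]] by (simp add: fdiff_def add_ac)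
qed (use assms in simp)

text \<open>Newton's forward expansion: polynomials of degree less than \<open>r\<close> are represented in the cyclic
  subspace generated by \<open>g\<close>, with \<open>B\<close> acting as the difference operator, so that \<open>I + B\<close> acts as
  the translation by one.\<close>

definition newton :: "('b::real_normed_vector \<Rightarrow>\<^sub>L 'b) \<Rightarrow> 'b \<Rightarrow> nat \<Rightarrow> (real \<Rightarrow> real) \<Rightarrow> 'b" where
  "newton B g r f = (\<Sum>j<r. (fdiff ^^ j) f 0 *\<^sub>R (blinfun_apply B ^^ (r - Suc j)) g)"

lemma newton_add_apply:
  assumes g: "(blinfun_apply B ^^ r) g = 0" and f: "(fdiff ^^ r) f = (\<lambda>_. 0)"
  shows "newton B g r f + B (newton B g r f) = newton B g r (\<lambda>t. f (t + 1))"
proof -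
  define h where "h j = (fdiff ^^ j) f 0 *\<^sub>R (blinfun_apply B ^^ (r - j)) g" for j
  have "B (newton B g r f) = (\<Sum>j<r. h j)"
    by (auto simp: newton_def h_def blinfun.sum_right blinfun.scaleR_right Suc_diff_Suc
        simp flip: funpow.simps(2)[unfolded o_def] intro!: sum.cong)
       (metis Suc_diff_Suc comp_apply funpow.simps(2))
  also have "\<dots> = (\<Sum>j<r. h (Suc j))"
    using sum.lessThan_Suc[of h r] sum.lessThan_Suc_shift[of h r] g f by (simp add: h_def)
  finally have "newton B g r f + B (newton B g r f)
      = (\<Sum>j<r. ((fdiff ^^ j) f 0 + (fdiff ^^ Suc j) f 0) *\<^sub>R (blinfun_apply B ^^ (r - Suc j)) g)"
    by (simp add: newton_def h_def scaleR_add_left sum.distrib del: funpow.simps)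
  then show ?thesis
    by (simp add: newton_def fdiff_funpow_shift) (simp add: fdiff_def)
qed

lemma newton_funpow:
  assumes g: "(blinfun_apply B ^^ r) g = 0" and f: "(fdiff ^^ r) f = (\<lambda>_. 0)"
  shows "((blinfun_apply (id_blinfun + B)) ^^ n) (newton B g r f) = newton B g r (\<lambda>t. f (t + real n))"
proof (induction n)
  case (Suc n)
  have "(fdiff ^^ r) (\<lambda>t. f (t + real n)) = (\<lambda>_. 0)"
    using f by (simp add: fdiff_funpow_shift)
  note step = newton_add_apply[OF g this]
  have "(blinfun_apply (id_blinfun + B) ^^ Suc n) (newton B g r f)
      = (id_blinfun + B) (newton B g r (\<lambda>t. f (t + real n)))"
    by (simp only: funpow.simps o_apply Suc)
  also have "\<dots> = newton B g r (\<lambda>t. f (t + real (Suc n)))"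
    using step by (simp add: blinfun.add_left add_ac)
  finally show ?case .
qed simp

lemma tendsto_newton:
  assumes "\<And>k :: nat. (\<lambda>n. F n (real k)) \<longlonglongrightarrow> f (real k)"
  shows "(\<lambda>n. newton B g r (F n)) \<longlonglongrightarrow> newton B g r f"
  unfolding newton_def
  using tendsto_fdiff_funpow[where F = F and f = f and k = 0, OF assms] by (auto intro!: tendsto_intros)

lemma newton_zero: "newton B g r (\<lambda>_. 0) = 0"
  by (simp add: newton_def fdiff_funpow_zero)

lemma newton_gbinomial:
  assumes "p < r"
  shows "newton B g r (\<lambda>t. t gchoose p) = (blinfun_apply B ^^ (r - Suc p)) g"
proof -
  have "(fdiff ^^ j) (\<lambda>t. t gchoose p) 0 = (if j = p then 1 else 0)" for j
  proof (cases "j \<le> p")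
    case True
    then show ?thesis by (auto simp: fdiff_funpow_gbinomial gbinomial_0_left)
  next
    case False
    then obtain i where j: "j = i + Suc p" by (metis add.commute add_Suc_right less_imp_Suc_add not_le)
    have "(fdiff ^^ j) (\<lambda>t. t gchoose p) = (\<lambda>_. 0)"
      unfolding j funpow_add o_apply fdiff_funpow_gbinomial_vanish by (rule fdiff_funpow_zero)
    with j show ?thesis by simp
  qed
  then have "newton B g r (\<lambda>t. t gchoose p)
      = (\<Sum>j<r. if j = p then (blinfun_apply B ^^ (r - Suc j)) g else 0)"
    unfolding newton_def by (intro sum.cong) auto
  also have "\<dots> = (blinfun_apply B ^^ (r - Suc p)) g"
    using assms by simp
  finally show ?thesis .
qed

lemma newton_in_subspace:
  fixes B :: "'b::real_normed_vector \<Rightarrow>\<^sub>L 'b"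
  assumes "subspace Z" "\<And>z. z \<in> Z \<Longrightarrow> B z \<in> Z" "g \<in> Z"
  shows "newton B g r f \<in> Z"
proof -
  have "(blinfun_apply B ^^ j) g \<in> Z" for j
    by (induction j) (use assms in auto)
  then show ?thesis
    unfolding newton_def by (intro subspace_sum subspace_scale assms)
qed

lemma tendsto_gbinomial_over_power:
  "(\<lambda>n. (s + c * real n gchoose q) * (t / real n) ^ Suc q) \<longlonglongrightarrow> 0"
proof -
  have *: "(s + c * real n gchoose q) * (t / real n) ^ Suc q
      = (\<Prod>i<q. (s + c * real n - real i) * (t / real n)) * (t / real n) / fact q" for n
    unfolding prod.distrib by (simp add: gbinomial_prod_rev lessThan_atLeast0 mult_ac)
  have "(\<lambda>n. (s + c * real n - real i) * (t / real n)) \<longlonglongrightarrow> c * t" for i :: nat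
  proof -
    have "(\<lambda>n. ((s - real i) / real n + c) * t) \<longlonglongrightarrow> (0 + c) * t"
      by (intro tendsto_intros lim_const_over_n)
    then have "(\<lambda>n. ((s - real i) / real n + c) * t) \<longlonglongrightarrow> c * t"
      by simp
    then show ?thesis
      by (rule Lim_transform_eventually)
         (auto intro!: eventually_mono[OF eventually_gt_at_top[of 0]] simp: field_simps)
  qed
  then have "(\<lambda>n. \<Prod>i<q. (s + c * real n - real i) * (t / real n)) \<longlonglongrightarrow> (\<Prod>i<q. c * t)"
    by (rule tendsto_prod)
  then have "(\<lambda>n. (\<Prod>i<q. (s + c * real n - real i) * (t / real n)) * (t / real n) / fact q)
      \<longlonglongrightarrow> (\<Prod>i<q. c * t) * 0 / fact q"
    by (rule tendsto_divide[OF tendsto_mult tendsto_const]) (auto intro: lim_const_over_n)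
  then show ?thesis unfolding * by simp
qed

text \<open>With \<open>Q t = (t gchoose q)\<close>, the polynomials \<open>Q (t - n) * (t / n) ^ Suc q\<close> tend to \<open>0\<close> while their
  translates by \<open>n\<close> tend to \<open>Q\<close>; dually \<open>Q t * (1 - t / n) ^ Suc q\<close> tends to \<open>Q\<close> while its translate
  tends to \<open>0\<close>.\<close>

lemma id_plus_nilpotent_orbits:
  fixes B :: "'b::real_normed_vector \<Rightarrow>\<^sub>L 'b"
  assumes Z: "subspace Z" "\<And>z. z \<in> Z \<Longrightarrow> B z \<in> Z" "g \<in> Z"
    and g: "(blinfun_apply B ^^ (2 * p)) g = 0" and p: "0 < p"
  shows "\<exists>y. (\<forall>n. y n \<in> Z) \<and> y \<longlonglongrightarrow> 0 \<and>
           (\<lambda>n. (blinfun_apply (id_blinfun + B) ^^ n) (y n)) \<longlonglongrightarrow> (blinfun_apply B ^^ p) g" (is ?A)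
    and "\<exists>y. (\<forall>n. y n \<in> Z) \<and> y \<longlonglongrightarrow> (blinfun_apply B ^^ p) g \<and>
           (\<lambda>n. (blinfun_apply (id_blinfun + B) ^^ n) (y n)) \<longlonglongrightarrow> 0" (is ?B)
proof -
  obtain q where q: "p = Suc q" using p gr0_conv_Suc by auto
  define N where "N = newton B g (2 * p)"
  have N0: "N (\<lambda>_. 0) = 0" by (simp add: N_def newton_zero)
  have NQ: "N (\<lambda>t. t gchoose q) = (blinfun_apply B ^^ p) g"
    by (simp add: N_def q newton_gbinomial)
  have NZ: "N f \<in> Z" for f
    unfolding N_def by (rule newton_in_subspace[OF Z])
  have pow: "(blinfun_apply (id_blinfun + B) ^^ n) (N f) = N (\<lambda>t. f (t + real n))"
    if "(fdiff ^^ (2 * p)) f = (\<lambda>_. 0)" for f n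
    unfolding N_def by (rule newton_funpow[OF g that])
  have lim: "(\<lambda>n. N (F n)) \<longlonglongrightarrow> N f" if "\<And>k :: nat. (\<lambda>n. F n (real k)) \<longlonglongrightarrow> f (real k)" for F f
    unfolding N_def by (rule tendsto_newton) (rule that)
  have deg: "(fdiff ^^ (2 * p)) (\<lambda>t. (a * t + b) ^ p * (t + c gchoose q)) = (\<lambda>_. 0)" for a b c
    using fdiff_funpow_affine_power_mult[of p "\<lambda>t. t + c gchoose q" p a b]
      fdiff_funpow_gbinomial_vanish[of q] fdiff_funpow_shift[of p "\<lambda>t. t gchoose q" c]
    unfolding q mult_2 by metis
  define F where "F n = (\<lambda>t. (1 / real n * t + 0) ^ p * (t + (- real n) gchoose q))" for n
  define G where "G n = (\<lambda>t. (- 1 / real n * t + 1) ^ p * (t + 0 gchoose q))" for n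
  have inv0: "(\<lambda>n. a / real n) \<longlonglongrightarrow> 0" for a by (rule lim_const_over_n)
  have ratio: "(\<lambda>n. (real k + real n) / real n) \<longlonglongrightarrow> 1" for k :: nat
  proof -
    have "(\<lambda>n. real k / real n + 1) \<longlonglongrightarrow> 1"
      using tendsto_add[OF inv0 tendsto_const] by simp
    then show ?thesis
      by (rule Lim_transform_eventually)
         (auto intro!: eventually_mono[OF eventually_gt_at_top[of 0]] simp: field_simps)
  qed
  have "(\<lambda>n. N (F n)) \<longlonglongrightarrow> N (\<lambda>_. 0)"
    by (rule lim) (use tendsto_gbinomial_over_power[of _ "- 1" q] in \<open>simp add: F_def q mult.commute\<close>)
  moreover have "(\<lambda>n. N (\<lambda>t. F n (t + real n))) \<longlonglongrightarrow> N (\<lambda>t. t gchoose q)"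
  proof (rule lim)
    fix k :: nat
    have "(\<lambda>n. ((real k + real n) / real n) ^ p * (real k gchoose q)) \<longlonglongrightarrow> 1 ^ p * (real k gchoose q)"
      by (intro tendsto_intros ratio)
    then show "(\<lambda>n. F n (real k + real n)) \<longlonglongrightarrow> (real k gchoose q)"
      by (simp add: F_def)
  qed
  moreover have "(blinfun_apply (id_blinfun + B) ^^ n) (N (F n)) = N (\<lambda>t. F n (t + real n))" for n
    by (rule pow) (simp only: F_def deg)
  ultimately show ?A
    by (intro exI[of _ "\<lambda>n. N (F n)"]) (simp add: NZ N0 NQ)
  have "(\<lambda>n. N (G n)) \<longlonglongrightarrow> N (\<lambda>t. t gchoose q)"
  proof (rule lim)
    fix k :: nat
    have "(\<lambda>n. (- real k / real n + 1) ^ p * (real k gchoose q)) \<longlonglongrightarrow> (0 + 1) ^ p * (real k gchoose q)"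
      by (intro tendsto_intros inv0)
    then show "(\<lambda>n. G n (real k)) \<longlonglongrightarrow> (real k gchoose q)"
      by (simp add: G_def)
  qed
  moreover have "(\<lambda>n. N (\<lambda>t. G n (t + real n))) \<longlonglongrightarrow> N (\<lambda>_. 0)"
  proof (rule lim)
    fix k :: nat
    show "(\<lambda>n. G n (real k + real n)) \<longlonglongrightarrow> 0"
    proof (rule Lim_transform_eventually)
      show "(\<lambda>n. (real k + 1 * real n gchoose q) * (- real k / real n) ^ Suc q) \<longlonglongrightarrow> 0"
        by (rule tendsto_gbinomial_over_power)
      show "\<forall>\<^sub>F n in sequentially.
          (real k + 1 * real n gchoose q) * (- real k / real n) ^ Suc q = G n (real k + real n)"
      proof (rule eventually_mono[OF eventually_gt_at_top[of 0]])
        fix n :: nat assume "0 < n"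
        then have "- 1 / real n * (real k + real n) + 1 = - real k / real n"
          by (simp add: field_simps)
        then show "(real k + 1 * real n gchoose q) * (- real k / real n) ^ Suc q = G n (real k + real n)"
          unfolding G_def q by simp
      qed
    qed
  qed
  moreover have "(blinfun_apply (id_blinfun + B) ^^ n) (N (G n)) = N (\<lambda>t. G n (t + real n))" for n
    by (rule pow) (simp only: G_def deg)
  ultimately show ?B
    by (intro exI[of _ "\<lambda>n. N (G n)"]) (simp add: NZ N0 NQ)
qed

section \<open>Dense orbits and transitivity\<close>

lemma (in banach_space_over) bounded_bilinear_scale: "bounded_bilinear smul"
proof
  show "smul (r *\<^sub>R a) b = r *\<^sub>R smul a b" for r a b
    by (simp add: scaleR_conv_of_real[of r a] flip: scale_of_real)
  show "smul a (r *\<^sub>R b) = r *\<^sub>R smul a b" for a b r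
    by (simp add: scale_left_commute flip: scale_of_real)
  show "\<exists>K. \<forall>a b. norm (smul a b) \<le> norm a * norm b * K"
    by (rule exI[of _ 1]) (simp add: norm_scale)
qed (simp_all add: scale_left_distrib scale_right_distrib)

lemma (in banach_space_over) subspace_imp_real_subspace:
  assumes "subspace S"
  shows "real_vector.subspace S"
  using assms unfolding real_vector.subspace_def subspace_def scale_of_real[symmetric] by blast

lemma (in banach_space_over) closed_line: "closed (range (\<lambda>c. smul c m))"
proof (cases "m = 0")
  case False
  have "complete (range (\<lambda>c. smul c m))"
    unfolding complete_def
  proof (intro allI impI, elim conjE)
    fix f :: "nat \<Rightarrow> 'a" assume f: "\<forall>n. f n \<in> range (\<lambda>c. smul c m)" and "Cauchy f"
    then obtain c where c: "f = (\<lambda>n. smul (c n) m)"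
      by (auto simp: image_iff) metis
    have eq: "dist (f i) (f j) = dist (c i) (c j) * norm m" for i j
      by (simp add: c dist_norm norm_scale flip: scale_left_diff_distrib)
    have "Cauchy c"
    proof (rule metric_CauchyI)
      fix e :: real assume "0 < e"
      then have "0 < e * norm m" using False by simp
      then obtain M where "\<forall>i\<ge>M. \<forall>j\<ge>M. dist (f i) (f j) < e * norm m"
        using \<open>Cauchy f\<close> unfolding Cauchy_def by blast
      then show "\<exists>M. \<forall>i\<ge>M. \<forall>j\<ge>M. dist (c i) (c j) < e"
        using False by (auto simp: eq)
    qed
    then obtain l where "c \<longlonglongrightarrow> l"
      by (auto simp: Cauchy_convergent_iff convergent_def)
    then have "f \<longlonglongrightarrow> smul l m"
      unfolding c by (intro bounded_bilinear.tendsto[OF bounded_bilinear_scale] tendsto_const)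
    then show "\<exists>l\<in>range (\<lambda>c. smul c m). f \<longlonglongrightarrow> l" by blast
  qed
  then show ?thesis by (rule complete_imp_closed)
qed auto

lemma (in banach_space_over) line_complement_dense:
  assumes Z: "subspace Z" and b: "b \<in> Z" "b \<notin> range (\<lambda>c. smul c m)"
  shows "Z \<subseteq> closure (Z - range (\<lambda>c. smul c m))"
proof
  fix a assume a: "a \<in> Z"
  show "a \<in> closure (Z - range (\<lambda>c. smul c m))"
  proof (cases "a \<in> range (\<lambda>c. smul c m)")
    case False
    then show ?thesis using a closure_subset by blast
  next
    case True
    then obtain d where d: "a = smul d m" by blast
    have "a + smul (of_real (1 / Suc n)) b \<in> Z - range (\<lambda>c. smul c m)" for n
    proof -
      have "b \<in> range (\<lambda>c. smul c m)" if "a + smul (of_real (1 / Suc n)) b = smul c m" for c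
      proof
        let ?t = "of_real (1 / Suc n) :: 'k"
        have t: "?t \<noteq> 0" unfolding of_real_eq_0_iff by simp
        have "smul ?t b = smul (c - d) m"
          using that d by (simp add: scale_left_diff_distrib algebra_simps)
        then have "smul (inverse ?t) (smul ?t b) = smul (inverse ?t * (c - d)) m"
          by simp
        then show "b = smul (inverse ?t * (c - d)) m" using t by simp
      qed auto
      then show ?thesis
        using b Z a by (auto simp: subspace_def)
    qed
    moreover have "(\<lambda>n. a + smul (of_real (1 / Suc n)) b) \<longlonglongrightarrow> a"
    proof -
      have "(\<lambda>n. a + (1 / Suc n) *\<^sub>R b) \<longlonglongrightarrow> a + 0 *\<^sub>R b"
        by (intro tendsto_intros LIMSEQ_inverse_real_of_nat[unfolded inverse_eq_divide])
      then show ?thesis unfolding scale_of_real by simp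
    qed
    ultimately show ?thesis
      unfolding closure_sequential
      by (intro exI[of _ "\<lambda>n. a + smul (of_real (1 / Suc n)) b"]) blast
  qed
qed

lemma dense_diff_closed:
  fixes Z :: "'b::metric_space set"
  assumes P: "Z \<subseteq> closure P" and L: "closed L" "Z \<subseteq> closure (Z - L)"
  shows "Z \<subseteq> closure (P - L)"
proof
  fix a assume "a \<in> Z"
  show "a \<in> closure (P - L)"
    unfolding closure_approachable
  proof (intro allI impI)
    fix e :: real assume e: "0 < e"
    then obtain b where b: "b \<in> Z" "b \<notin> L" "dist b a < e / 2"
      using L(2) \<open>a \<in> Z\<close> unfolding closure_approachable
      by (metis DiffE closure_approachable half_gt_zero subset_iff)
    have "open (- L)" using L(1) by auto
    then obtain r where r: "0 < r" "ball b r \<subseteq> - L"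
      using b(2) open_contains_ball by blast
    obtain p where p: "p \<in> P" "dist p b < min r (e / 2)"
      using P b(1) e r(1) unfolding closure_approachable subset_iff
      by (metis closure_approachable half_gt_zero min_less_iff_conj)
    have "p \<notin> L" using r(2) p(2) by (auto simp: dist_commute)
    moreover have "dist p a < e"
      using b(3) p(2) dist_triangle_half_l[of p b e a] by (simp add: dist_commute dist_triangle_half_r)
    ultimately show "\<exists>y\<in>P - L. dist y a < e" using p(1) by blast
  qed
qed

lemma (in banach_space_over) dense_diff_lines:
  assumes Z: "subspace Z" "\<And>m. \<not> Z \<subseteq> range (\<lambda>c. smul c m)"
    and P: "Z \<subseteq> closure P" and M: "finite M"
  shows "Z \<subseteq> closure (P - (\<Union>m\<in>M. range (\<lambda>c. smul c m)))"
  using M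
proof induction
  case (insert m M)
  obtain b where "b \<in> Z" "b \<notin> range (\<lambda>c. smul c m)" using Z(2)[of m] by blast
  from dense_diff_closed[OF insert.IH closed_line line_complement_dense[OF Z(1) this]]
  moreover have "P - (\<Union>m\<in>insert m M. range (\<lambda>c. smul c m))
      = P - (\<Union>m\<in>M. range (\<lambda>c. smul c m)) - range (\<lambda>c. smul c m)"
    by auto
  ultimately show ?case by simp
qed (use P in simp)

lemma Baire_closed:
  fixes N :: "'b::complete_space set"
  assumes "closed N" "countable \<G>"
    and "\<And>G. G \<in> \<G> \<Longrightarrow> openin (top_of_set N) G \<and> N \<subseteq> closure G"
  shows "N \<subseteq> closure (N \<inter> \<Inter>\<G>)"
proof -
  have closure_of: "top_of_set N closure_of G = N \<longleftrightarrow> N \<subseteq> closure (N \<inter> G)" for G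
    by (auto simp: closure_of_subtopology)
  have "completely_metrizable_space (top_of_set N)"
    using assms(1) completely_metrizable_space_closedin completely_metrizable_space_euclidean
    by (metis closed_closedin)
  moreover have "openin (top_of_set N) G \<and> top_of_set N closure_of G = topspace (top_of_set N)"
    if "G \<in> \<G>" for G
    using assms(3)[OF that] openin_subset[of "top_of_set N" G]
    by (simp add: closure_of inf.absorb2)
  ultimately have "top_of_set N closure_of \<Inter>\<G> = topspace (top_of_set N)"
    using assms(2) by (intro Baire_category) auto
  then show ?thesis by (simp add: closure_of)
qed

text \<open>The multipliers range over \<open>C\<close>; supercyclicity is the case \<open>C = UNIV\<close> and hypercyclicity the
  case \<open>C = {1}\<close>.\<close>

definition orbit_dense ::
    "('k \<Rightarrow> 'b \<Rightarrow> 'b::metric_space) \<Rightarrow> 'k set \<Rightarrow> 'b set \<Rightarrow> ('b \<Rightarrow> 'b) \<Rightarrow> bool" where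
  "orbit_dense sm C Z S \<longleftrightarrow> (\<exists>z\<in>Z. Z \<subseteq> closure {sm c ((S ^^ n) z) | c n. c \<in> C})"

definition moves_near ::
    "('k \<Rightarrow> 'b \<Rightarrow> 'b::metric_space) \<Rightarrow> 'k set \<Rightarrow> 'b set \<Rightarrow> 'b \<Rightarrow> 'b \<Rightarrow> real \<Rightarrow> ('b \<Rightarrow> 'b) \<Rightarrow> bool" where
  "moves_near sm C Z u v e S \<longleftrightarrow>
     (\<exists>c\<in>C. \<exists>n. \<exists>w\<in>Z. dist w u < e \<and> dist (sm c ((S ^^ n) w)) v < e)"

lemma funpow_mem: "z \<in> Z \<Longrightarrow> (\<And>z. z \<in> Z \<Longrightarrow> S z \<in> Z) \<Longrightarrow> (S ^^ n) z \<in> Z"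
  by (induction n) auto

lemma top_of_set_closure_of_eq_iff:
  "P \<subseteq> Z \<Longrightarrow> top_of_set Z closure_of P = Z \<longleftrightarrow> Z \<subseteq> closure P"
  by (auto simp: closure_of_subtopology inf.absorb2)

lemma openin_UN: "(\<And>i. i \<in> I \<Longrightarrow> openin X (f i)) \<Longrightarrow> openin X (\<Union>i\<in>I. f i)"
  by (rule openin_Union) auto

lemma openin_dist_less:
  fixes f :: "'b::topological_space \<Rightarrow> 'c::metric_space"
  assumes "continuous_on N f"
  shows "openin (top_of_set N) {x \<in> N. dist (f x) v < e}"
proof -
  have "{x \<in> N. dist (f x) v < e} = N \<inter> f -` ball v e"
    by (auto simp: dist_commute)
  then show ?thesis
    using continuous_openin_preimage_gen[OF assms open_ball] by simp
qed

lemma continuous_on_blinfun_funpow: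
  fixes A :: "'t::topological_space \<Rightarrow> 'b::real_normed_vector \<Rightarrow>\<^sub>L 'b"
  assumes "continuous_on M A" "continuous_on M w"
  shows "continuous_on M (\<lambda>t. (blinfun_apply (A t) ^^ n) (w t))"
  by (induction n) (use assms in \<open>auto intro!: continuous_intros\<close>)

context banach_space_over
begin

lemma supercyclic_iff_orbit_dense:
  assumes "subspace Z" "\<And>z. z \<in> Z \<Longrightarrow> S z \<in> Z"
  shows "supercyclic smul Z S \<longleftrightarrow> orbit_dense smul UNIV Z S"
  unfolding supercyclic_def orbit_dense_def
proof (rule bex_cong[OF refl])
  fix z assume "z \<in> Z"
  with assms have "{smul c ((S ^^ n) z) | c n. True} \<subseteq> Z"
    by (auto intro!: subspace_scale funpow_mem)
  from top_of_set_closure_of_eq_iff[OF this]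
  show "(top_of_set Z closure_of {smul c ((S ^^ n) z) | c n. True} = Z) \<longleftrightarrow>
      Z \<subseteq> closure {smul c ((S ^^ n) z) | c n. c \<in> UNIV}" by simp
qed

lemma hypercyclic_iff_orbit_dense:
  assumes "\<And>z. z \<in> Z \<Longrightarrow> S z \<in> Z"
  shows "hypercyclic Z S \<longleftrightarrow> orbit_dense smul {1} Z S"
  unfolding hypercyclic_def orbit_dense_def
proof (rule bex_cong[OF refl])
  fix z assume "z \<in> Z"
  with assms have "{(S ^^ n) z | n. True} \<subseteq> Z"
    by (auto intro!: funpow_mem)
  from top_of_set_closure_of_eq_iff[OF this]
  show "(top_of_set Z closure_of {(S ^^ n) z | n. True} = Z) \<longleftrightarrow>
      Z \<subseteq> closure {smul c ((S ^^ n) z) | c n. c \<in> {1}}" by simp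
qed

lemma funpow_scale:
  assumes "subspace Z" "\<And>z. z \<in> Z \<Longrightarrow> S z \<in> Z" "\<And>c z. z \<in> Z \<Longrightarrow> S (smul c z) = smul c (S z)" "z \<in> Z"
  shows "(S ^^ n) (smul c z) = smul c ((S ^^ n) z)"
  by (induction n) (simp_all add: assms funpow_mem)

text \<open>Removing finitely many lines from a dense set keeps it dense, so the tails of a dense projective
  orbit are dense as well.\<close>

lemma orbit_dense_imp_moves_near:
  assumes Z: "subspace Z" "\<And>m. \<not> Z \<subseteq> range (\<lambda>c. smul c m)"
    and S: "\<And>z. z \<in> Z \<Longrightarrow> S z \<in> Z" "\<And>c z. z \<in> Z \<Longrightarrow> S (smul c z) = smul c (S z)"
    and C: "\<And>c d. c \<in> C \<Longrightarrow> d \<in> C \<Longrightarrow> c \<noteq> 0 \<Longrightarrow> d / c \<in> C"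
    and dense: "orbit_dense smul C Z S" and uv: "u \<in> Z" "v \<in> Z" and e: "0 < e"
  shows "moves_near smul C Z u v e S"
proof -
  let ?L = "\<lambda>M. \<Union>m\<in>M. range (\<lambda>c. smul c m)"
  obtain z where z: "z \<in> Z" and P: "Z \<subseteq> closure {smul c ((S ^^ n) z) | c n. c \<in> C}" (is "_ \<subseteq> closure ?P")
    using dense by (auto simp: orbit_dense_def)
  have "Z \<subseteq> closure (?P - ?L {0})"
    by (rule dense_diff_lines[OF Z P]) auto
  then obtain x where x: "x \<in> ?P - ?L {0}" "dist x u < e"
    using uv(1) e unfolding subset_iff closure_approachable by blast
  then obtain c k where c: "c \<in> C" "x = smul c ((S ^^ k) z)" "c \<noteq> 0" by auto
  have "Z \<subseteq> closure (?P - ?L ((\<lambda>j. (S ^^ j) z) ` {..<k}))"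
    by (rule dense_diff_lines[OF Z P]) auto
  then obtain y where y: "y \<in> ?P - ?L ((\<lambda>j. (S ^^ j) z) ` {..<k})" "dist y v < e"
    using uv(2) e unfolding subset_iff closure_approachable by blast
  then obtain d n where d: "d \<in> C" "y = smul d ((S ^^ n) z)" by auto
  have "\<not> n < k" using y(1) d(2) by auto
  then have "(S ^^ n) z = (S ^^ (n - k)) ((S ^^ k) z)"
    by (simp flip: o_apply[of "S ^^ (n - k)" "S ^^ k"] funpow_add)
  then have "y = smul (d / c) ((S ^^ (n - k)) x)"
    using c d z Z(1) S by (simp add: funpow_scale funpow_mem)
  moreover have "x \<in> Z"
    using c(2) z Z(1) S by (simp add: subspace_scale funpow_mem)
  ultimately show ?thesis
    unfolding moves_near_def using C[OF c(1) d(1) c(3)] x(2) y(2) by blast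
qed

lemma openin_dist_scale_funpow_less:
  fixes A :: "'t::topological_space \<Rightarrow> 'a \<Rightarrow>\<^sub>L 'a"
  assumes "continuous_on N A" "continuous_on N w"
  shows "openin (top_of_set N) {t \<in> N. dist (smul c ((blinfun_apply (A t) ^^ n) (w t))) v < e}"
  by (rule openin_dist_less, rule bounded_bilinear.continuous_on[OF bounded_bilinear_scale],
      rule continuous_on_const, rule continuous_on_blinfun_funpow[OF assms])

lemma moves_near_imp_orbit_dense:
  assumes Z: "closed Z" "Z \<noteq> {}"
    and D: "countable D" "D \<subseteq> Z" "Z \<subseteq> closure D"
    and near: "\<And>u v k. u \<in> D \<Longrightarrow> v \<in> D \<Longrightarrow>
        moves_near smul C Z u v (inverse (real (Suc k))) (blinfun_apply B)"
  shows "orbit_dense smul C Z (blinfun_apply B)"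
proof -
  define G where "G = (\<lambda>(v, k). {w \<in> Z. \<exists>c\<in>C. \<exists>n. dist (smul c ((blinfun_apply B ^^ n) w)) v < inverse (real (Suc k))})"
  have "Z \<subseteq> closure (Z \<inter> \<Inter>(G ` (D \<times> UNIV)))"
  proof (rule Baire_closed[OF Z(1)])
    show "countable (G ` (D \<times> UNIV))" using D(1) by auto
    fix H assume "H \<in> G ` (D \<times> UNIV)"
    then obtain v k where v: "v \<in> D" and H: "H = G (v, k)" by auto
    have "openin (top_of_set Z) {w \<in> Z. dist (smul c ((blinfun_apply B ^^ n) w)) v < inverse (real (Suc k))}" for c n
      by (rule openin_dist_scale_funpow_less) (rule continuous_on_const, rule continuous_on_id)
    then have "openin (top_of_set Z) (\<Union>c\<in>C. \<Union>n. {w \<in> Z. dist (smul c ((blinfun_apply B ^^ n) w)) v < inverse (real (Suc k))})"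
      by (intro openin_UN)
    moreover have "H = (\<Union>c\<in>C. \<Union>n. {w \<in> Z. dist (smul c ((blinfun_apply B ^^ n) w)) v < inverse (real (Suc k))})"
      unfolding H G_def by auto
    ultimately have "openin (top_of_set Z) H"
      by simp
    moreover have "Z \<subseteq> closure H"
    proof
      fix a assume a: "a \<in> Z"
      show "a \<in> closure H"
        unfolding closure_approachable
      proof (intro allI impI)
        fix e :: real assume e: "0 < e"
        then obtain u where u: "u \<in> D" "dist u a < e / 2"
          using D(3) a unfolding subset_iff closure_approachable by (metis half_gt_zero)
        obtain j where j: "inverse (real (Suc j)) < e / 2"
          using reals_Archimedean e half_gt_zero by blast
        define i where "i = max j k"
        have "inverse (real (Suc i)) \<le> inverse (real (Suc j))" "inverse (real (Suc i)) \<le> inverse (real (Suc k))"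
          by (auto simp: i_def intro!: le_imp_inverse_le)
        moreover obtain c n w where w: "c \<in> C" "w \<in> Z" "dist w u < inverse (real (Suc i))"
          "dist (smul c ((blinfun_apply B ^^ n) w)) v < inverse (real (Suc i))"
          using near[OF u(1) v, of i] unfolding moves_near_def by blast
        ultimately have "dist (smul c ((blinfun_apply B ^^ n) w)) v < inverse (real (Suc k))"
          by linarith
        then have "w \<in> H"
          using w(1,2) unfolding H G_def by blast
        moreover have "dist w a < e"
          using dist_triangle[of w a u] u(2) w(3) j \<open>inverse (real (Suc i)) \<le> inverse (real (Suc j))\<close>
          by linarith
        ultimately show "\<exists>y\<in>H. dist y a < e" by blast
      qed
    qed
    ultimately show "openin (top_of_set Z) H \<and> Z \<subseteq> closure H" ..
  qed
  then have "Z \<inter> \<Inter>(G ` (D \<times> UNIV)) \<noteq> {}"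
    using Z(2) by force
  then obtain z where z: "z \<in> Z" "\<And>v k. v \<in> D \<Longrightarrow> z \<in> G (v, k)" by blast
  have "D \<subseteq> closure {smul c ((blinfun_apply B ^^ n) z) | c n. c \<in> C}" (is "_ \<subseteq> closure ?P")
  proof
    fix v assume v: "v \<in> D"
    show "v \<in> closure ?P"
      unfolding closure_approachable
    proof (intro allI impI)
      fix e :: real assume "0 < e"
      then obtain k where "inverse (real (Suc k)) < e" using reals_Archimedean by blast
      with z(2)[OF v, of k] show "\<exists>y\<in>?P. dist y v < e"
        unfolding G_def by (auto intro: less_trans)
    qed
  qed
  then have "Z \<subseteq> closure ?P"
    using D(3) by (meson closure_minimal closed_closure order_trans)
  with z(1) show ?thesis unfolding orbit_dense_def by blast
qed

lemma moves_near_openin: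
  assumes "continuous_on N A"
  shows "openin (top_of_set N) {T \<in> N. moves_near smul C Z u v e (blinfun_apply (A T))}"
proof -
  have "openin (top_of_set N) {T \<in> N. dist (smul c ((blinfun_apply (A T) ^^ n) w)) v < e}" for c n w
    by (intro openin_dist_scale_funpow_less assms continuous_on_const)
  moreover have "{T \<in> N. moves_near smul C Z u v e (blinfun_apply (A T))}
      = (\<Union>c\<in>C. \<Union>n. \<Union>w\<in>{w\<in>Z. dist w u < e}.
           {T \<in> N. dist (smul c ((blinfun_apply (A T) ^^ n) w)) v < e})"
    unfolding moves_near_def by blast
  ultimately show ?thesis by (simp add: openin_UN)
qed

end

definition residual_in :: "'b::topological_space set \<Rightarrow> 'b set \<Rightarrow> bool" where
  "residual_in N S \<longleftrightarrow> (\<exists>\<G>. countable \<G> \<and>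
     (\<forall>G\<in>\<G>. openin (top_of_set N) G \<and> N \<subseteq> closure G) \<and> S = N \<inter> \<Inter>\<G>)"

lemma residual_in_Int:
  assumes "residual_in N S" "residual_in N S'"
  shows "residual_in N (S \<inter> S')"
proof -
  obtain \<G> \<G>' where "countable \<G>" "countable \<G>'" "S = N \<inter> \<Inter>\<G>" "S' = N \<inter> \<Inter>\<G>'"
    and "\<forall>G\<in>\<G> \<union> \<G>'. openin (top_of_set N) G \<and> N \<subseteq> closure G"
    using assms unfolding residual_in_def by (metis Un_iff)
  then show ?thesis
    unfolding residual_in_def by (intro exI[of _ "\<G> \<union> \<G>'"]) (simp, blast)
qed

lemma residual_in_imp_dense_gdelta:
  fixes N :: "'b::complete_space set"
  assumes N: "closed N" and S: "residual_in N S"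
  shows "dense_gdelta_in (top_of_set N) S"
proof -
  obtain \<G> where \<G>: "countable \<G>" "S = N \<inter> \<Inter>\<G>"
    and G: "\<And>G. G \<in> \<G> \<Longrightarrow> openin (top_of_set N) G \<and> N \<subseteq> closure G"
    using S by (auto simp: residual_in_def)
  have "N \<subseteq> closure S" unfolding \<G>(2) by (rule Baire_closed[OF N \<G>(1) G])
  then have "top_of_set N closure_of S = topspace (top_of_set N)"
    using \<G>(2) by (subst topspace_euclidean_subtopology) (auto simp: top_of_set_closure_of_eq_iff)
  moreover have "gdelta_in (top_of_set N) (\<Inter>(insert N \<G>))"
    by (rule gdelta_in_Inter) (use \<G>(1) G in \<open>auto intro: open_imp_gdelta_in\<close>)
  then have "gdelta_in (top_of_set N) S"
    using \<G>(2) by simp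
  ultimately show ?thesis by (simp add: dense_gdelta_in_def)
qed

context banach_space_over
begin

lemma residual_orbit_dense:
  assumes Z: "closed Z" "subspace Z" "\<And>m. \<not> Z \<subseteq> range (\<lambda>c. smul c m)"
    and sep: "separable_space (top_of_set Z)"
    and A: "continuous_on N A"
      "\<And>T z. T \<in> N \<Longrightarrow> z \<in> Z \<Longrightarrow> blinfun_apply (A T) z \<in> Z"
      "\<And>T c z. T \<in> N \<Longrightarrow> z \<in> Z \<Longrightarrow> blinfun_apply (A T) (smul c z) = smul c (blinfun_apply (A T) z)"
    and C: "\<And>c d. c \<in> C \<Longrightarrow> d \<in> C \<Longrightarrow> c \<noteq> 0 \<Longrightarrow> d / c \<in> C"
    and dense: "\<And>u v e. u \<in> Z \<Longrightarrow> v \<in> Z \<Longrightarrow> 0 < e \<Longrightarrow>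
        N \<subseteq> closure {T \<in> N. moves_near smul C Z u v e (blinfun_apply (A T))}"
  shows "residual_in N {T \<in> N. orbit_dense smul C Z (blinfun_apply (A T))}"
proof -
  obtain D where D: "countable D" "D \<subseteq> Z" "Z \<subseteq> closure D"
    using sep unfolding separable_space_def
    by (auto simp: top_of_set_closure_of_eq_iff)
  define G where "G = (\<lambda>(u, v, k :: nat). {T \<in> N. moves_near smul C Z u v (inverse (real (Suc k))) (blinfun_apply (A T))})"
  have "Z \<noteq> {}" using subspace_0[OF Z(2)] by blast
  have iff: "orbit_dense smul C Z (blinfun_apply (A T)) \<longleftrightarrow> (\<forall>i \<in> D \<times> D \<times> UNIV. T \<in> G i)" if T: "T \<in> N" for T
  proof
    assume "orbit_dense smul C Z (blinfun_apply (A T))"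
    then have "moves_near smul C Z u v (inverse (real (Suc k))) (blinfun_apply (A T))"
      if "u \<in> D" "v \<in> D" for u v k
      by (intro orbit_dense_imp_moves_near[OF Z(2,3) A(2,3)[OF T] C]) (use that D(2) in auto)
    then have "T \<in> G (u, v, k)" if "u \<in> D" "v \<in> D" for u v k
      using T that unfolding G_def by simp
    then show "\<forall>i \<in> D \<times> D \<times> UNIV. T \<in> G i"
      by simp
  next
    assume *: "\<forall>i \<in> D \<times> D \<times> UNIV. T \<in> G i"
    have "moves_near smul C Z u v (inverse (real (Suc k))) (blinfun_apply (A T))"
      if "u \<in> D" "v \<in> D" for u v k
      using bspec[OF *, of "(u, v, k)"] that by (simp add: G_def)
    then show "orbit_dense smul C Z (blinfun_apply (A T))"
      by (rule moves_near_imp_orbit_dense[OF Z(1) \<open>Z \<noteq> {}\<close> D])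
  qed
  have "{T \<in> N. orbit_dense smul C Z (blinfun_apply (A T))} = N \<inter> \<Inter>(G ` (D \<times> D \<times> UNIV))"
    unfolding set_eq_iff mem_Collect_eq Int_iff INT_iff using iff by metis
  moreover have "openin (top_of_set N) H \<and> N \<subseteq> closure H" if "H \<in> G ` (D \<times> D \<times> UNIV)" for H
  proof -
    obtain u v k where H: "H = G (u, v, k)" and uv: "u \<in> Z" "v \<in> Z"
      using \<open>H \<in> _\<close> D(2) by auto
    show ?thesis
      using moves_near_openin[OF A(1)] dense[OF uv] by (simp add: H G_def)
  qed
  moreover have "countable (G ` (D \<times> D \<times> UNIV))" using D(1) by auto
  ultimately show ?thesis unfolding residual_in_def by (intro exI[of _ "G ` (D \<times> D \<times> UNIV)"]) metis
qed

end

section \<open>Functionals and biorthogonal systems\<close>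

lemma real_or_complex_cases:
  obtains (real) "\<And>c :: 'k::real_or_complex. \<exists>r. c = of_real r"
  | (complex) i :: "'k::real_or_complex" where "i * i = - 1" "\<And>c. \<exists>a b. c = of_real a + of_real b * i"
proof -
  obtain \<phi> :: "'k \<Rightarrow> complex" where
    add: "\<And>x y. \<phi> (x + y) = \<phi> x + \<phi> y" and mult: "\<And>x y. \<phi> (x * y) = \<phi> x * \<phi> y"
    and scaleR: "\<And>r x. \<phi> (r *\<^sub>R x) = r *\<^sub>R \<phi> x" and norm: "\<And>x. norm (\<phi> x) = norm x"
    and range: "range \<phi> = \<real> \<or> range \<phi> = UNIV"
    using real_or_complex_embedding[where 'a = 'k] by blast
  have one: "\<phi> 1 = 1"
    using mult[of 1 1] norm[of 1] by auto
  have of_real: "\<phi> (of_real r) = of_real r" for r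
    using scaleR[of r 1] by (simp add: one scaleR_conv_of_real)
  have neg: "\<phi> (- x) = - \<phi> x" for x
    using scaleR[of "- 1" x] by simp
  have inj: "x = y" if "\<phi> x = \<phi> y" for x y
    using add[of x "- y"] norm[of "x - y"] that by (simp add: neg)
  from range show thesis
  proof
    assume r: "range \<phi> = \<real>"
    have "\<exists>r. c = of_real r" for c :: 'k
    proof -
      have "\<phi> c \<in> \<real>" using r by blast
      then show ?thesis using inj of_real by (metis Reals_cases)
    qed
    with real show thesis by blast
  next
    assume r: "range \<phi> = UNIV"
    then obtain i where i: "\<phi> i = \<i>" by (metis UNIV_I imageE)
    have "i * i = - 1"
      by (rule inj) (simp add: mult i neg one)
    moreover have "\<exists>a b. c = of_real a + of_real b * i" for c :: 'k
      by (intro exI[of _ "Re (\<phi> c)"] exI[of _ "Im (\<phi> c)"] inj)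
         (simp add: add mult of_real i complex_eq_iff)
    ultimately show thesis using complex by blast
  qed
qed

context banach_space_over
begin

lemma dual_add: "f \<in> dual smul \<Longrightarrow> g \<in> dual smul \<Longrightarrow> f + g \<in> dual smul"
  by (simp add: dual_def blinfun.add_left distrib_left)

lemma dual_scaleR: "f \<in> dual smul \<Longrightarrow> r *\<^sub>R f \<in> dual smul"
  by (simp add: dual_def blinfun.scaleR_left)

lemma dual_smul: "f \<in> dual smul \<Longrightarrow> blinfun_apply f (smul c x) = c * blinfun_apply f x"
  by (simp add: dual_def)

lemma ex_dual_separating_nonzero:
  assumes S: "subspace S" "closed S" and e: "e \<notin> S"
  shows "\<exists>f\<in>dual smul. (\<forall>x\<in>S. blinfun_apply f x = 0) \<and> blinfun_apply f e \<noteq> 0"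
proof -
  obtain u :: "'a \<Rightarrow> real" where u: "bounded_linear u" "\<And>x. x \<in> S \<Longrightarrow> u x = 0" "u e \<noteq> 0"
    using ex_bounded_linear_separating[OF subspace_imp_real_subspace[OF S(1)] S(2) e] by blast
  interpret u: bounded_linear u by fact
  have smul: "bounded_linear (smul c)" for c
    by (rule bounded_bilinear.bounded_linear_right[OF bounded_bilinear_scale])
  have of_real_u: "bounded_linear (\<lambda>x. of_real (u x) :: 'k)"
    by (rule bounded_linear_compose[OF bounded_linear_of_real u(1)])
  have smul_of_real: "u (smul (of_real r) x) = r * u x" for r x
    by (simp add: scale_of_real u.scaleR)
  show ?thesis
  proof (cases rule: real_or_complex_cases[where 'k = 'k])
    case real
    have "Blinfun (\<lambda>x. of_real (u x)) \<in> dual smul"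
      unfolding dual_def mem_Collect_eq bounded_linear_Blinfun_apply[OF of_real_u]
    proof (intro allI)
      fix c :: 'k and x
      obtain r where "c = of_real r" using real by blast
      then show "of_real (u (smul c x)) = c * of_real (u x)" by (simp add: smul_of_real)
    qed
    then show ?thesis
      by (rule bexI[rotated]) (simp add: bounded_linear_Blinfun_apply[OF of_real_u] u)
  next
    case (complex i)
    define f where "f x = of_real (u x) - i * of_real (u (smul i x))" for x
    have f: "bounded_linear f"
      unfolding f_def[abs_def]
      by (intro bounded_linear_sub of_real_u bounded_linear_compose[OF bounded_linear_mult_right]
          bounded_linear_compose[OF of_real_u smul])
    interpret f: bounded_linear f by fact
    have ii: "smul i (smul i x) = - x" for x
      by (simp add: complex)
    have f_real: "f (smul (of_real r) x) = of_real r * f x" for r x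
      by (simp add: scale_of_real f.scaleR scaleR_conv_of_real)
    have "i * f x = i * of_real (u x) - (i * i) * of_real (u (smul i x))" for x
      by (simp add: f_def algebra_simps)
    then have f_i: "f (smul i x) = i * f x" for x
      unfolding complex(1) by (simp only: f_def[of "smul i x"] ii) (simp add: u.neg)
    have "Blinfun f \<in> dual smul"
      unfolding dual_def mem_Collect_eq bounded_linear_Blinfun_apply[OF f]
    proof (intro allI)
      fix c :: 'k and x
      obtain a b where "c = of_real a + of_real b * i" using complex(2) by blast
      then show "f (smul c x) = c * f x"
        by (simp add: scale_left_distrib f.add f_real f_i distrib_right mult.assoc flip: scale_scale)
    qed
    moreover have "f x = 0" if "x \<in> S" for x
      using that S(1) by (simp add: f_def u(2) subspace_scale)
    moreover have "f e \<noteq> 0"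
    proof
      assume "f e = 0"
      then have eq: "of_real (u e) = i * of_real (u (smul i e))" by (simp add: f_def)
      have "of_real (u e * u e) = (i * i) * of_real (u (smul i e) * u (smul i e))"
        unfolding of_real_mult eq by (simp add: mult_ac)
      then have "of_real (u e * u e) = (of_real (- (u (smul i e) * u (smul i e))) :: 'k)"
        by (simp add: complex)
      then have "u e * u e = - (u (smul i e) * u (smul i e))"
        by (simp only: of_real_eq_iff)
      then show False
        using u(3) by (smt (verit) mult_pos_pos mult_neg_neg zero_le_square not_real_square_gt_zero)
    qed
    ultimately show ?thesis
      by (intro bexI[of _ "Blinfun f"]) (auto simp: bounded_linear_Blinfun_apply[OF f])
  qed
qed

theorem ex_dual_separating:
  assumes "subspace S" "closed S" "e \<notin> S"
  shows "\<exists>f\<in>dual smul. (\<forall>x\<in>S. blinfun_apply f x = 0) \<and> blinfun_apply f e = 1"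
proof -
  obtain f where f: "f \<in> dual smul" "\<And>x. x \<in> S \<Longrightarrow> blinfun_apply f x = 0" "blinfun_apply f e \<noteq> 0"
    using ex_dual_separating_nonzero[OF assms] by blast
  show ?thesis
    by (rule bexI[of _ "dual_scale (inverse (blinfun_apply f e)) f"])
       (use f in \<open>auto simp: dual_scale_apply dual_def\<close>)
qed

lemma closed_span_finite:
  assumes "finite B"
  shows "closed (span B)"
  using assms
proof induction
  case (insert e B)
  show ?case
  proof (cases "e \<in> span B")
    case True
    then show ?thesis using insert.IH by (simp add: span_redundant)
  next
    case False
    obtain f where f: "f \<in> dual smul" "\<And>x. x \<in> span B \<Longrightarrow> blinfun_apply f x = 0" "blinfun_apply f e = 1"
      using ex_dual_separating[OF subspace_span insert.IH False] by blast
    have "k = blinfun_apply f x" if "x - smul k e \<in> span B" for x k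
      using f(2)[OF that] f(1,3) by (simp add: blinfun.diff_right dual_smul)
    then have "span (insert e B) = (\<lambda>x. x - smul (blinfun_apply f x) e) -` span B"
      unfolding span_insert by auto
    moreover have "continuous_on UNIV (\<lambda>x. x - smul (blinfun_apply f x) e)"
      by (intro continuous_intros bounded_bilinear.continuous_on[OF bounded_bilinear_scale])
    ultimately show ?thesis using insert.IH by (simp add: closed_vimage)
  qed
qed simp

lemma ex_dual_separating_finite:
  assumes "finite B" "e \<notin> span B"
  shows "\<exists>f\<in>dual smul. (\<forall>x\<in>span B. blinfun_apply f x = 0) \<and> blinfun_apply f e = 1"
  by (intro ex_dual_separating subspace_span closed_span_finite assms)

lemma ex_annihilated_not_in_span:
  assumes inf: "infinite_dimensional smul" and C: "finite C" "C \<subseteq> dual smul" and B: "finite B"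
  shows "\<exists>x. (\<forall>g\<in>C. blinfun_apply g x = 0) \<and> x \<notin> span B"
  using C B
proof (induction C arbitrary: B)
  case empty
  then show ?case using inf unfolding infinite_dimensional_def by blast
next
  case (insert g C)
  show ?case
  proof (cases "\<exists>w. (\<forall>h\<in>C. blinfun_apply h w = 0) \<and> blinfun_apply g w \<noteq> 0")
    case True
    then obtain w where w: "\<And>h. h \<in> C \<Longrightarrow> blinfun_apply h w = 0" "blinfun_apply g w \<noteq> 0" by blast
    obtain x where x: "\<And>h. h \<in> C \<Longrightarrow> blinfun_apply h x = 0" "x \<notin> span (insert w B)"
      using insert.IH[of "insert w B"] insert.prems by auto
    let ?y = "x - smul (blinfun_apply g x / blinfun_apply g w) w"
    have "blinfun_apply h ?y = 0" if "h \<in> insert g C" for h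
      using that insert.prems(1) w x(1) by (auto simp: blinfun.diff_right dual_smul)
    moreover have "?y \<notin> span B"
      using x(2) unfolding span_insert by blast
    ultimately show ?thesis by blast
  next
    case False
    then show ?thesis using insert.IH[of B] insert.prems by auto
  qed
qed

lemma ex_biorthogonal:
  fixes n :: nat
  assumes inf: "infinite_dimensional smul" and C: "finite C" "C \<subseteq> dual smul" and B: "finite B"
  shows "\<exists>e f. (\<forall>i<n. (\<forall>g\<in>C. blinfun_apply g (e i) = 0) \<and> f i \<in> dual smul \<and>
      (\<forall>b\<in>span B. blinfun_apply (f i) b = 0)) \<and>
      (\<forall>i<n. \<forall>j<n. blinfun_apply (f i) (e j) = (if i = j then 1 else (0 :: 'k)))"
proof (induction n)
  case (Suc n)
  then obtain e and f :: "nat \<Rightarrow> 'a \<Rightarrow>\<^sub>L 'k"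
    where *: "\<forall>i<n. (\<forall>g\<in>C. blinfun_apply g (e i) = 0) \<and> f i \<in> dual smul \<and>
      (\<forall>b\<in>span B. blinfun_apply (f i) b = 0)"
      and **: "\<forall>i<n. \<forall>j<n. blinfun_apply (f i) (e j) = (if i = j then 1 else 0)"
    by blast
  have e: "blinfun_apply g (e i) = 0" if "i < n" "g \<in> C" for i g
    using * that by blast
  have f: "f i \<in> dual smul" "b \<in> span B \<Longrightarrow> blinfun_apply (f i) b = 0" if "i < n" for i b
    using * that by blast+
  have fe: "blinfun_apply (f i) (e j) = (if i = j then 1 else 0)" if "i < n" "j < n" for i j
    using ** that by blast
  have "\<exists>x. (\<forall>g\<in>C \<union> f ` {..<n}. blinfun_apply g x = 0) \<and> x \<notin> span (B \<union> e ` {..<n})"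
    by (rule ex_annihilated_not_in_span[OF inf]) (use C B f(1) in auto)
  then obtain x where x: "\<And>g. g \<in> C \<Longrightarrow> blinfun_apply g x = 0" "\<And>i. i < n \<Longrightarrow> blinfun_apply (f i) x = 0"
    "x \<notin> span (B \<union> e ` {..<n})" by auto
  obtain g where g: "g \<in> dual smul" "\<And>y. y \<in> span (B \<union> e ` {..<n}) \<Longrightarrow> blinfun_apply g y = 0"
    "blinfun_apply g x = 1"
    using ex_dual_separating_finite[OF _ x(3)] B by auto
  have gB: "blinfun_apply g b = 0" if "b \<in> span B" for b
    using g(2) that span_mono[of B "B \<union> e ` {..<n}"] by auto
  have ge: "blinfun_apply g (e i) = 0" if "i < n" for i
    by (rule g(2)[OF span_base]) (use that in auto)
  show ?case
    by (rule exI[of _ "e(n := x)"], rule exI[of _ "f(n := g)"])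
       (auto simp: less_Suc_eq e f fe x g gB ge)
qed simp

lemma finite_rank_kernel_functionals:
  assumes T: "T \<in> operators smul" "finite_rank smul T"
  shows "\<exists>C. finite C \<and> C \<subseteq> dual smul \<and>
    (\<forall>x. (\<forall>g\<in>C. blinfun_apply g x = 0) \<longrightarrow> blinfun_apply T x = 0)"
proof -
  obtain B0 where B0: "finite B0" "range (blinfun_apply T) \<subseteq> span B0"
    using T(2) by (auto simp: finite_rank_def)
  obtain B where B: "B \<subseteq> B0" "independent B" "B0 \<subseteq> span B"
    using maximal_independent_subset[of B0] by blast
  have fin: "finite B" using B(1) B0(1) by (rule finite_subset)
  have range: "blinfun_apply T x \<in> span B" for x
    using B0(2) span_mono[OF B(3)] by (auto simp: span_span)
  have "\<exists>f\<in>dual smul. (\<forall>x\<in>span (B - {b}). blinfun_apply f x = 0) \<and> blinfun_apply f b = 1" if "b \<in> B" for b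
    by (rule ex_dual_separating_finite) (use fin B(2) that in \<open>auto simp: dependent_def\<close>)
  then obtain f where f: "\<And>b. b \<in> B \<Longrightarrow> f b \<in> dual smul" "\<And>b. b \<in> B \<Longrightarrow> blinfun_apply (f b) b = 1"
    "\<And>b x. b \<in> B \<Longrightarrow> x \<in> span (B - {b}) \<Longrightarrow> blinfun_apply (f b) x = 0"
    by metis
  have "f b o\<^sub>L T \<in> dual smul" if "b \<in> B" for b
    using f(1)[OF that] T(1) by (simp add: dual_def operators_def)
  moreover have "blinfun_apply T x = 0" if x: "\<And>b. b \<in> B \<Longrightarrow> blinfun_apply (f b) (blinfun_apply T x) = 0" for x
  proof -
    obtain c where c: "blinfun_apply T x = (\<Sum>b\<in>B. smul (c b) b)"
      using range[of x] unfolding span_finite[OF fin] by auto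
    have "c b = 0" if b: "b \<in> B" for b
    proof -
      have "blinfun_apply (f b) (blinfun_apply T x) = (\<Sum>b'\<in>B. c b' * blinfun_apply (f b) b')"
        unfolding c using f(1)[OF b] by (simp add: blinfun.sum_right dual_smul)
      also have "\<dots> = (\<Sum>b'\<in>B. if b' = b then c b else 0)"
        by (rule sum.cong) (use f(2,3)[OF b] in \<open>auto intro: span_base\<close>)
      finally show ?thesis using x[OF b] b fin by simp
    qed
    then show ?thesis unfolding c by simp
  qed
  ultimately show ?thesis
    using fin by (intro exI[of _ "(\<lambda>b. f b o\<^sub>L T) ` B"]) auto
qed

end

section \<open>Perturbations of finite rank nilpotent operators\<close>

lemma nilpotent_scaleR:
  assumes "nilpotent T"
  shows "nilpotent (r *\<^sub>R T)"
proof -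
  obtain n where n: "\<And>x. (blinfun_apply T ^^ n) x = 0"
    using assms by (auto simp: nilpotent_def)
  have "(blinfun_apply (r *\<^sub>R T) ^^ k) x = r ^ k *\<^sub>R (blinfun_apply T ^^ k) x" for k x
  proof (induction k)
    case (Suc k)
    then show ?case by (simp only: funpow.simps o_apply Suc blinfun.scaleR_left blinfun.scaleR_right)
        (simp add: mult.commute)
  qed simp
  then have "(blinfun_apply (r *\<^sub>R T) ^^ n) x = 0" for x
    by (simp only: n scaleR_zero_right)
  then show ?thesis unfolding nilpotent_def by blast
qed

text \<open>If \<open>A B = 0\<close> then \<open>A (A + B) ^ k = A ^ (k + 1)\<close>, so \<open>A + B\<close> acts as \<open>B\<close> from some power on.\<close>

lemma nilpotent_add:
  assumes AB: "\<And>x. blinfun_apply A (blinfun_apply B x) = 0" and "nilpotent A" "nilpotent B"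
  shows "nilpotent (A + B)"
proof -
  obtain m where m: "\<And>x. (blinfun_apply A ^^ m) x = 0"
    using assms(2) by (auto simp: nilpotent_def)
  obtain n where n: "\<And>x. (blinfun_apply B ^^ n) x = 0"
    using assms(3) by (auto simp: nilpotent_def)
  let ?S = "blinfun_apply (A + B)"
  have A: "blinfun_apply A ((?S ^^ k) x) = (blinfun_apply A ^^ Suc k) x" for k x
  proof (induction k)
    case (Suc k)
    have "blinfun_apply A ((?S ^^ Suc k) x) = blinfun_apply A (blinfun_apply A ((?S ^^ k) x))"
      by (simp only: funpow.simps o_apply blinfun.add_left blinfun.add_right AB add_0_right)
    then show ?case by (simp only: Suc) simp
  qed simp
  have Am: "blinfun_apply A ((?S ^^ (j + m)) x) = 0" for j x
  proof -
    have "(blinfun_apply A ^^ Suc (j + m)) x = (blinfun_apply A ^^ Suc j) ((blinfun_apply A ^^ m) x)"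
      unfolding add_Suc[symmetric] funpow_add o_apply ..
    then show ?thesis unfolding A by (simp only: m blinfun_funpow_zero)
  qed
  have "(?S ^^ (j + m)) x = (blinfun_apply B ^^ j) ((?S ^^ m) x)" for j x
  proof (induction j)
    case (Suc j)
    have "(?S ^^ (Suc j + m)) x = blinfun_apply A ((?S ^^ (j + m)) x) + blinfun_apply B ((?S ^^ (j + m)) x)"
      by (simp only: add_Suc funpow.simps o_apply blinfun.add_left)
    also have "\<dots> = blinfun_apply B ((?S ^^ (j + m)) x)"
      by (simp only: Am add_0_left)
    also have "\<dots> = (blinfun_apply B ^^ Suc j) ((?S ^^ m) x)"
      by (simp only: Suc funpow.simps o_apply)
    finally show ?case .
  qed simp
  then have "(?S ^^ (n + m)) x = 0" for x by (simp only: n)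
  then show ?thesis unfolding nilpotent_def by (intro exI allI)
qed

lemma funpow_chain:
  fixes c :: "nat \<Rightarrow> 'b::real_vector"
  assumes "\<And>r x. F (r *\<^sub>R x) = r *\<^sub>R F x" "\<And>j. j < p \<Longrightarrow> F (c (Suc j)) = d *\<^sub>R c j" "j \<le> p"
  shows "(F ^^ j) (c j) = d ^ j *\<^sub>R c 0"
  using assms(3)
proof (induction j)
  case (Suc j)
  have "(F ^^ k) (r *\<^sub>R x) = r *\<^sub>R (F ^^ k) x" for k r x
    by (induction k) (simp_all add: assms(1))
  moreover have "(F ^^ Suc j) (c (Suc j)) = (F ^^ j) (d *\<^sub>R c j)"
    using Suc.prems by (simp add: funpow_Suc_right assms(2) del: funpow.simps)
  ultimately show ?case
    using Suc by (simp only:) simp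
qed simp

context banach_space_over
begin

definition rank_one :: "('a \<Rightarrow>\<^sub>L 'k) \<Rightarrow> 'a \<Rightarrow> 'a \<Rightarrow>\<^sub>L 'a" where
  "rank_one f a = Blinfun (\<lambda>x. smul (blinfun_apply f x) a)"

lemma rank_one_apply: "blinfun_apply (rank_one f a) x = smul (blinfun_apply f x) a"
proof -
  have "bounded_linear (\<lambda>x. smul (blinfun_apply f x) a)"
    by (rule bounded_linear_compose[OF bounded_bilinear.bounded_linear_left[OF bounded_bilinear_scale]
          blinfun.bounded_linear_right])
  then show ?thesis by (simp add: rank_one_def bounded_linear_Blinfun_apply)
qed

definition rank_one_sum :: "nat \<Rightarrow> (nat \<Rightarrow> 'a \<Rightarrow>\<^sub>L 'k) \<Rightarrow> (nat \<Rightarrow> 'a) \<Rightarrow> 'a \<Rightarrow>\<^sub>L 'a" where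
  "rank_one_sum n b a = (\<Sum>i<n. rank_one (b i) (a i))"

lemma rank_one_sum_apply:
  "blinfun_apply (rank_one_sum n b a) x = (\<Sum>i<n. smul (blinfun_apply (b i) x) (a i))"
  by (simp add: rank_one_sum_def blinfun.sum_left rank_one_apply)

lemma rank_one_sum_operators:
  "(\<And>i. i < n \<Longrightarrow> b i \<in> dual smul) \<Longrightarrow> rank_one_sum n b a \<in> operators smul"
  by (auto simp: operators_def rank_one_sum_apply dual_smul scale_sum_right intro!: sum.cong)

lemma operators_add: "S \<in> operators smul \<Longrightarrow> T \<in> operators smul \<Longrightarrow> S + T \<in> operators smul"
  by (simp add: operators_def blinfun.add_left scale_right_distrib)

lemma operators_scaleR: "T \<in> operators smul \<Longrightarrow> r *\<^sub>R T \<in> operators smul"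
  by (simp add: operators_def blinfun.scaleR_left scale_left_commute flip: scale_of_real)

lemma finite_rank_add_rank_one_sum:
  assumes "finite_rank smul T"
  shows "finite_rank smul (T + r *\<^sub>R rank_one_sum n b a)"
proof -
  obtain B where B: "finite B" "range (blinfun_apply T) \<subseteq> span B"
    using assms by (auto simp: finite_rank_def)
  let ?B = "B \<union> a ` {..<n}"
  have "blinfun_apply T x \<in> span ?B" for x
    using B(2) span_mono[of B ?B] by auto
  moreover have "smul (of_real r) (\<Sum>i<n. smul (blinfun_apply (b i) x) (a i)) \<in> span ?B" for x
    by (intro span_scale span_sum span_base) auto
  ultimately have "range (blinfun_apply (T + r *\<^sub>R rank_one_sum n b a)) \<subseteq> span ?B"
    by (auto simp: blinfun.add_left blinfun.scaleR_left rank_one_sum_apply scale_of_real intro!: span_add)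
  then show ?thesis
    unfolding finite_rank_def using B(1) by (intro exI[of _ ?B]) simp
qed

lemma nilpotent_rank_one_sum:
  fixes r :: "nat \<Rightarrow> nat"
  assumes b: "\<And>i. i < n \<Longrightarrow> b i \<in> dual smul"
    and tri: "\<And>i j. i < n \<Longrightarrow> j < n \<Longrightarrow> blinfun_apply (b i) (a j) \<noteq> 0 \<Longrightarrow> r i < r j"
    and bound: "\<And>i. i < n \<Longrightarrow> r i < N"
  shows "nilpotent (rank_one_sum n b a)"
proof -
  let ?S = "blinfun_apply (rank_one_sum n b a)"
  have apply_S: "blinfun_apply (b i) (?S y) = (\<Sum>j<n. blinfun_apply (b j) y * blinfun_apply (b i) (a j))"
    if "i < n" for i y
    using b[OF that] by (simp add: rank_one_sum_apply blinfun.sum_right dual_smul)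
  have *: "blinfun_apply (b i) ((?S ^^ k) x) = 0" if "i < n" "N \<le> r i + k" for i k x
    using that
  proof (induction k arbitrary: i)
    case 0
    then show ?case using bound[of i] by simp
  next
    case (Suc k)
    have "blinfun_apply (b j) ((?S ^^ k) x) * blinfun_apply (b i) (a j) = 0" if "j < n" for j
      using tri[OF Suc.prems(1) that] Suc.IH[OF that] Suc.prems(2) by fastforce
    then have "blinfun_apply (b i) (?S ((?S ^^ k) x)) = 0"
      unfolding apply_S[OF Suc.prems(1)] by (intro sum.neutral) simp
    then show ?case by simp
  qed
  have "(?S ^^ Suc N) x = 0" for x
  proof -
    have "?S ((?S ^^ N) x) = 0"
      unfolding rank_one_sum_apply[of n b a "(?S ^^ N) x"] by (intro sum.neutral) (simp add: *)
    then show ?thesis by simp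
  qed
  then show ?thesis unfolding nilpotent_def by blast
qed

end

text \<open>At the pair \<open>(u, v)\<close> this gives the transitivity needed for \<open>F\<close> to be supercyclic and the one
  needed for \<open>I + F\<close> to be hypercyclic.\<close>

definition chains_to :: "'b::real_normed_vector set \<Rightarrow> ('b \<Rightarrow> 'b) \<Rightarrow> 'b \<Rightarrow> 'b \<Rightarrow> bool" where
  "chains_to Z F u v \<longleftrightarrow> (\<exists>p>0. (F ^^ p) u = 0 \<and> (F ^^ p) v = 0 \<and>
     (\<exists>g\<in>Z. (F ^^ p) g = u) \<and> (\<exists>h\<in>Z. (F ^^ p) h = v))"

lemma chains_toI:
  fixes e :: "nat \<Rightarrow> 'b::real_normed_vector"
  assumes F: "\<And>r x. F (r *\<^sub>R x) = r *\<^sub>R F x" and p: "0 < p" "d \<noteq> 0"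
    and u: "(F ^^ p) u = 0" and v: "(F ^^ p) v = 0"
    and g: "\<And>j. j < p \<Longrightarrow> F (e j) = d *\<^sub>R (case_nat u e) j"
    and h: "\<And>j. j < p \<Longrightarrow> F (e (p + j)) = d *\<^sub>R (case_nat v (\<lambda>j. e (p + j))) j"
    and Z: "\<And>j. j < 2 * p \<Longrightarrow> inverse (d ^ p) *\<^sub>R e j \<in> Z"
  shows "chains_to Z F u v"
proof -
  have scale: "(F ^^ k) (r *\<^sub>R x) = r *\<^sub>R (F ^^ k) x" for k r x
    by (induction k) (simp_all add: F)
  obtain q where q: "p = Suc q" using p(1) gr0_conv_Suc by auto
  have top: "(F ^^ p) (inverse (d ^ p) *\<^sub>R y) = x" if "(F ^^ p) y = d ^ p *\<^sub>R x" for x y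
    unfolding scale that using p(2) by simp
  have "(F ^^ p) (case_nat u e p) = d ^ p *\<^sub>R u"
    using funpow_chain[where c = "case_nat u e" and F = F and p = p and j = p and d = d] F g by simp
  then have "(F ^^ p) (inverse (d ^ p) *\<^sub>R e q) = u"
    by (intro top) (simp only: q nat.case)
  moreover have "(F ^^ p) (case_nat v (\<lambda>j. e (p + j)) p) = d ^ p *\<^sub>R v"
    using funpow_chain[where c = "case_nat v (\<lambda>j. e (p + j))" and F = F and p = p and j = p and d = d] F h
    by simp
  then have "(F ^^ p) (inverse (d ^ p) *\<^sub>R e (p + q)) = v"
    by (intro top) (simp only: q nat.case)
  moreover have "inverse (d ^ p) *\<^sub>R e q \<in> Z" "inverse (d ^ p) *\<^sub>R e (p + q) \<in> Z"
    using q by (intro Z; simp)+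
  ultimately show ?thesis
    unfolding chains_to_def using p(1) u v by blast
qed

context banach_space_over
begin

lemma ex_small_perturbation:
  assumes T0: "T0 \<in> operators smul" "finite_rank smul T0" and e: "0 < \<epsilon>"
    and b: "\<And>i. i < n \<Longrightarrow> b i \<in> dual smul"
    and nil: "\<And>d. nilpotent (T0 + d *\<^sub>R rank_one_sum n b a)"
  shows "\<exists>d. d \<noteq> 0 \<and> T0 + d *\<^sub>R rank_one_sum n b a \<in> {T \<in> operators smul. finite_rank smul T \<and> nilpotent T} \<and>
    dist (T0 + d *\<^sub>R rank_one_sum n b a) T0 < \<epsilon>"
proof -
  define d where "d = \<epsilon> / (norm (rank_one_sum n b a) + 1)"
  have pos: "0 < norm (rank_one_sum n b a) + 1" by (simp add: add_nonneg_pos)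
  then have "0 < d" using e by (simp add: d_def)
  moreover have "d * norm (rank_one_sum n b a) < \<epsilon>"
    using pos e unfolding d_def by (simp add: field_simps)
  ultimately show ?thesis
    by (intro exI[of _ d]) (simp add: T0 nil b dist_norm operators_add operators_scaleR
        rank_one_sum_operators finite_rank_add_rank_one_sum)
qed

lemma perturbation_chains_to:
  assumes inf: "infinite_dimensional smul"
    and T0: "T0 \<in> operators smul" "finite_rank smul T0" "nilpotent T0" and e: "0 < \<epsilon>"
  shows "\<exists>T\<in>{T \<in> operators smul. finite_rank smul T \<and> nilpotent T}.
    dist T T0 < \<epsilon> \<and> chains_to UNIV (blinfun_apply T) u v"
proof -
  obtain m where m: "\<And>x. (blinfun_apply T0 ^^ m) x = 0"
    using T0(3) by (auto simp: nilpotent_def)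
  define p where "p = Suc m"
  have p: "0 < p" "\<And>x. (blinfun_apply T0 ^^ p) x = 0"
    by (simp_all add: p_def m)
  obtain B where B: "finite B" "range (blinfun_apply T0) \<subseteq> span B"
    using T0(2) by (auto simp: finite_rank_def)
  obtain C where C: "finite C" "C \<subseteq> dual smul"
    "\<forall>x. (\<forall>g\<in>C. blinfun_apply g x = 0) \<longrightarrow> blinfun_apply T0 x = 0"
    using finite_rank_kernel_functionals[OF T0(1,2)] by blast
  have "finite (B \<union> {u, v})" using B(1) by simp
  from ex_biorthogonal[OF inf C(1,2) this, of "2 * p"]
  obtain e and f :: "nat \<Rightarrow> 'a \<Rightarrow>\<^sub>L 'k"
    where *: "\<forall>i<2 * p. (\<forall>g\<in>C. blinfun_apply g (e i) = 0) \<and> f i \<in> dual smul \<and>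
      (\<forall>b\<in>span (B \<union> {u, v}). blinfun_apply (f i) b = 0)"
      and **: "\<forall>i<2 * p. \<forall>j<2 * p. blinfun_apply (f i) (e j) = (if i = j then 1 else 0)"
    by blast
  have T0e: "blinfun_apply T0 (e i) = 0" if "i < 2 * p" for i
    using * that C(3) by blast
  have f: "f i \<in> dual smul" "b \<in> span (B \<union> {u, v}) \<Longrightarrow> blinfun_apply (f i) b = 0" if "i < 2 * p" for i b
    using * that by blast+
  have fuv: "blinfun_apply (f i) u = 0" "blinfun_apply (f i) v = 0" if "i < 2 * p" for i
    using f(2)[OF that] by (simp_all add: span_base)
  have fT0: "blinfun_apply (f i) (blinfun_apply T0 x) = 0" if "i < 2 * p" for i x
    by (rule f(2)[OF that]) (use B(2) span_mono[of B "B \<union> {u, v}"] in auto)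
  have fe: "blinfun_apply (f i) (e j) = (if i = j then 1 else 0)" if "i < 2 * p" "j < 2 * p" for i j
    using ** that by blast
  define a where "a j = (if j < p then case_nat u e j else case_nat v (\<lambda>j. e (p + j)) (j - p))" for j
  have fa: "blinfun_apply (f i) (a j) = 0 \<or> j = Suc i" if "i < 2 * p" "j < 2 * p" for i j
    using that fuv[of i] fe by (auto simp: a_def split: nat.splits if_splits)
  define S where "S = rank_one_sum (2 * p) f a"
  have ST0: "blinfun_apply S (blinfun_apply T0 x) = 0" for x
    by (simp add: S_def rank_one_sum_apply fT0)
  have Suv: "blinfun_apply S u = 0" "blinfun_apply S v = 0"
    by (simp_all add: S_def rank_one_sum_apply fuv)
  have Se: "blinfun_apply S (e j) = a j" if "j < 2 * p" for j
  proof -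
    have "blinfun_apply S (e j) = (\<Sum>i<2 * p. if i = j then a j else 0)"
      unfolding S_def rank_one_sum_apply by (rule sum.cong) (use that in \<open>auto simp: fe\<close>)
    then show ?thesis using that by simp
  qed
  have "nilpotent S"
    unfolding S_def
    by (rule nilpotent_rank_one_sum[where r = "\<lambda>i. i" and N = "2 * p"]) (use f(1) fa in auto)
  then have "nilpotent (T0 + d *\<^sub>R S)" for d
    using nilpotent_add[of "d *\<^sub>R S" T0] T0(3) ST0
    by (simp add: nilpotent_scaleR blinfun.scaleR_left add.commute)
  then obtain d where d: "d \<noteq> 0" "T0 + d *\<^sub>R S \<in> {T \<in> operators smul. finite_rank smul T \<and> nilpotent T}"
    "dist (T0 + d *\<^sub>R S) T0 < \<epsilon>"
    using ex_small_perturbation[OF T0(1,2) \<open>0 < \<epsilon>\<close>, of "2 * p" f a] f(1) unfolding S_def by blast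
  let ?T = "blinfun_apply (T0 + d *\<^sub>R S)"
  have T: "?T x = blinfun_apply T0 x + d *\<^sub>R blinfun_apply S x" for x
    by (simp add: blinfun.add_left blinfun.scaleR_left)
  have same: "(?T ^^ k) x = (blinfun_apply T0 ^^ k) x" if "blinfun_apply S x = 0" for k x
  proof (induction k)
    case (Suc k)
    have kill: "blinfun_apply S ((blinfun_apply T0 ^^ k) x) = 0"
      using that ST0 by (cases k) auto
    have "(?T ^^ Suc k) x = ?T ((blinfun_apply T0 ^^ k) x)"
      by (simp only: funpow.simps o_apply Suc)
    also have "\<dots> = (blinfun_apply T0 ^^ Suc k) x"
      by (simp add: T kill)
    finally show ?case .
  qed simp
  have "chains_to UNIV ?T u v"
  proof (rule chains_toI[where p = p and d = d and e = e])
    show "(?T ^^ p) u = 0" "(?T ^^ p) v = 0"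
      by (simp_all only: same Suv p(2))
    show "?T (e j) = d *\<^sub>R case_nat u e j" if "j < p" for j
      using that by (simp add: T T0e Se a_def)
    show "?T (e (p + j)) = d *\<^sub>R case_nat v (\<lambda>j. e (p + j)) j" if "j < p" for j
      using that by (simp add: T T0e Se a_def)
  qed (use p d blinfun.scaleR_right in auto)
  with d show ?thesis by blast
qed

lemma funpow_dual_map:
  "blinfun_apply ((dual_map T ^^ k) f) x = blinfun_apply f ((blinfun_apply T ^^ k) x)"
proof (induction k arbitrary: x)
  case (Suc k)
  have "blinfun_apply ((dual_map T ^^ Suc k) f) x = blinfun_apply ((dual_map T ^^ k) f) (blinfun_apply T x)"
    by (simp add: dual_map_def)
  then show ?case by (simp only: Suc funpow_Suc_right o_apply)
qed simp

lemma perturbation_dual_chains_to: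
  assumes inf: "infinite_dimensional smul"
    and T0: "T0 \<in> operators smul" "finite_rank smul T0" "nilpotent T0" and e: "0 < \<epsilon>"
    and \<phi>: "\<phi> \<in> dual smul" and \<psi>: "\<psi> \<in> dual smul"
  shows "\<exists>T\<in>{T \<in> operators smul. finite_rank smul T \<and> nilpotent T}.
    dist T T0 < \<epsilon> \<and> chains_to (dual smul) (dual_map T) \<phi> \<psi>"
proof -
  obtain m where m: "\<And>x. (blinfun_apply T0 ^^ m) x = 0"
    using T0(3) by (auto simp: nilpotent_def)
  define p where "p = Suc m"
  have p: "0 < p" "\<And>x. (blinfun_apply T0 ^^ p) x = 0"
    by (simp_all add: p_def m)
  obtain B where B: "finite B" "range (blinfun_apply T0) \<subseteq> span B"
    using T0(2) by (auto simp: finite_rank_def)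
  obtain C where C: "finite C" "C \<subseteq> dual smul"
    "\<forall>x. (\<forall>g\<in>C. blinfun_apply g x = 0) \<longrightarrow> blinfun_apply T0 x = 0"
    using finite_rank_kernel_functionals[OF T0(1,2)] by blast
  have "finite (C \<union> {\<phi>, \<psi>})" "C \<union> {\<phi>, \<psi>} \<subseteq> dual smul" using C \<phi> \<psi> by auto
  from ex_biorthogonal[OF inf this B(1), of "2 * p"]
  obtain e and f :: "nat \<Rightarrow> 'a \<Rightarrow>\<^sub>L 'k"
    where *: "\<forall>i<2 * p. (\<forall>g\<in>C \<union> {\<phi>, \<psi>}. blinfun_apply g (e i) = 0) \<and> f i \<in> dual smul \<and>
      (\<forall>b\<in>span B. blinfun_apply (f i) b = 0)"
      and **: "\<forall>i<2 * p. \<forall>j<2 * p. blinfun_apply (f i) (e j) = (if i = j then 1 else 0)"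
    by blast
  have T0e: "blinfun_apply T0 (e i) = 0" if "i < 2 * p" for i
    using * that C(3) by blast
  have \<phi>\<psi>e: "blinfun_apply \<phi> (e i) = 0" "blinfun_apply \<psi> (e i) = 0" if "i < 2 * p" for i
    using * that by blast+
  have f: "f i \<in> dual smul" if "i < 2 * p" for i
    using * that by blast
  have fT0: "blinfun_apply (f i) (blinfun_apply T0 x) = 0" if "i < 2 * p" for i x
    using * that B(2) by blast
  have fe: "blinfun_apply (f i) (e j) = (if i = j then 1 else 0)" if "i < 2 * p" "j < 2 * p" for i j
    using ** that by blast
  define b where "b j = (if j < p then case_nat \<phi> f j else case_nat \<psi> (\<lambda>j. f (p + j)) (j - p))" for j
  have b: "b i \<in> dual smul" if "i < 2 * p" for i
    using that f \<phi> \<psi> by (auto simp: b_def split: nat.splits)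
  have be: "blinfun_apply (b i) (e j) = 0 \<or> i = Suc j" if "i < 2 * p" "j < 2 * p" for i j
    using that \<phi>\<psi>e[of j] fe by (auto simp: b_def split: nat.splits if_splits)
  define S where "S = rank_one_sum (2 * p) b e"
  have T0S: "blinfun_apply T0 (blinfun_apply S x) = 0" for x
    using T0(1) by (simp add: S_def rank_one_sum_apply blinfun.sum_right operators_def T0e)
  have \<phi>\<psi>S: "blinfun_apply \<phi> (blinfun_apply S x) = 0" "blinfun_apply \<psi> (blinfun_apply S x) = 0" for x
    using \<phi> \<psi> by (simp_all add: S_def rank_one_sum_apply blinfun.sum_right dual_smul \<phi>\<psi>e)
  have fS: "blinfun_apply (f j) (blinfun_apply S x) = blinfun_apply (b j) x" if "j < 2 * p" for j x
  proof -
    have "blinfun_apply (f j) (blinfun_apply S x) = (\<Sum>i<2 * p. if i = j then blinfun_apply (b j) x else 0)"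
      unfolding S_def rank_one_sum_apply blinfun.sum_right
      by (rule sum.cong) (use that f in \<open>auto simp: fe dual_smul\<close>)
    then show ?thesis using that by simp
  qed
  have "nilpotent S"
    unfolding S_def
    by (rule nilpotent_rank_one_sum[where r = "\<lambda>i. 2 * p - i" and N = "Suc (2 * p)"])
       (use b be in \<open>auto intro!: diff_less_mono2\<close>)
  then have "nilpotent (T0 + d *\<^sub>R S)" for d
    using nilpotent_add[of T0 "d *\<^sub>R S"] T0(3) T0S
    by (simp add: nilpotent_scaleR blinfun.scaleR_left blinfun.scaleR_right)
  then obtain d where d: "d \<noteq> 0" "T0 + d *\<^sub>R S \<in> {T \<in> operators smul. finite_rank smul T \<and> nilpotent T}"
    "dist (T0 + d *\<^sub>R S) T0 < \<epsilon>"
    using ex_small_perturbation[OF T0(1,2) \<open>0 < \<epsilon>\<close>, of "2 * p" b e] b unfolding S_def by blast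
  let ?T = "blinfun_apply (T0 + d *\<^sub>R S)"
  have T: "?T x = blinfun_apply T0 x + d *\<^sub>R blinfun_apply S x" for x
    by (simp add: blinfun.add_left blinfun.scaleR_left)
  have T0T: "blinfun_apply T0 ((?T ^^ k) x) = (blinfun_apply T0 ^^ Suc k) x" for k x
  proof (induction k)
    case (Suc k)
    have "blinfun_apply T0 ((?T ^^ Suc k) x) = blinfun_apply T0 (blinfun_apply T0 ((?T ^^ k) x))"
      by (simp only: funpow.simps o_apply T blinfun.add_right blinfun.scaleR_right T0S) simp
    then show ?case by (simp only: Suc) simp
  qed simp
  have kill: "blinfun_apply \<theta> ((?T ^^ p) x) = 0" if "\<And>x. blinfun_apply \<theta> (blinfun_apply S x) = 0" for \<theta> :: "'a \<Rightarrow>\<^sub>L 'k" and x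
  proof -
    have "blinfun_apply \<theta> ((?T ^^ Suc m) x) = blinfun_apply \<theta> ((blinfun_apply T0 ^^ Suc m) x)"
      by (simp only: funpow.simps(2)[of _ "blinfun_apply (T0 + d *\<^sub>R S)"] o_apply T
          blinfun.add_right blinfun.scaleR_right that T0T) simp
    also have "\<dots> = 0"
      using p(2) by (simp only: p_def) simp
    finally show ?thesis by (simp only: p_def)
  qed
  have T': "dual_map (T0 + d *\<^sub>R S) (f j) = d *\<^sub>R b j" if "j < 2 * p" for j
    by (rule blinfun_eqI) (simp add: dual_map_def T blinfun.add_right blinfun.scaleR_right
        blinfun.scaleR_left fT0[OF that] fS[OF that])
  have "chains_to (dual smul) (dual_map (T0 + d *\<^sub>R S)) \<phi> \<psi>"
  proof (rule chains_toI[where p = p and d = d and e = f])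
    show "(dual_map (T0 + d *\<^sub>R S) ^^ p) \<phi> = 0" "(dual_map (T0 + d *\<^sub>R S) ^^ p) \<psi> = 0"
      by (rule blinfun_eqI, simp only: funpow_dual_map kill \<phi>\<psi>S blinfun.zero_left)+
    show "dual_map (T0 + d *\<^sub>R S) (r *\<^sub>R \<theta>) = r *\<^sub>R dual_map (T0 + d *\<^sub>R S) \<theta>" for r \<theta>
      by (rule blinfun_eqI) (simp add: dual_map_def blinfun.scaleR_left)
    show "dual_map (T0 + d *\<^sub>R S) (f j) = d *\<^sub>R case_nat \<phi> f j" if "j < p" for j
      using that by (simp add: T' b_def)
    show "dual_map (T0 + d *\<^sub>R S) (f (p + j)) = d *\<^sub>R case_nat \<psi> (\<lambda>j. f (p + j)) j" if "j < p" for j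
      using that by (simp add: T' b_def)
  qed (use p d f dual_scaleR in auto)
  with d show ?thesis by blast
qed

end

section \<open>Genericity\<close>

context banach_space_over
begin

lemma chains_to_imp_moves_near:
  assumes Z: "subspace Z" "\<And>z. z \<in> Z \<Longrightarrow> blinfun_apply B z \<in> Z"
    and uv: "u \<in> Z" "v \<in> Z" and chains: "chains_to Z (blinfun_apply B) u v" and e: "0 < e"
  shows "moves_near smul UNIV Z u v e (blinfun_apply B)"
    and "moves_near smul {1} Z u v e (blinfun_apply (id_blinfun + B))"
proof -
  note Z' = subspace_imp_real_subspace[OF Z(1)]
  obtain p g h where p: "0 < p" and u0: "(blinfun_apply B ^^ p) u = 0" and v0: "(blinfun_apply B ^^ p) v = 0"
    and g: "g \<in> Z" "(blinfun_apply B ^^ p) g = u" and h: "h \<in> Z" "(blinfun_apply B ^^ p) h = v"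
    using chains unfolding chains_to_def by blast
  show "moves_near smul UNIV Z u v e (blinfun_apply B)"
  proof -
    define t where "t = e / (norm h + 1)"
    have t: "0 < t" "t * norm h < e"
    proof -
      have pos: "0 < norm h + 1" by (simp add: add_nonneg_pos)
      then show "0 < t" using e by (simp add: t_def)
      have "e * norm h < e * (norm h + 1)"
        using e by (intro mult_strict_left_mono) simp_all
      then show "t * norm h < e"
        using pos by (simp add: t_def field_simps)
    qed
    have "u + t *\<^sub>R h \<in> Z"
      using Z' uv(1) h(1) by (intro real_vector.subspace_add real_vector.subspace_scale)
    moreover have "dist (u + t *\<^sub>R h) u < e"
      using t by (simp add: dist_norm)
    moreover have "smul (of_real (inverse t)) ((blinfun_apply B ^^ p) (u + t *\<^sub>R h)) = v"
      unfolding blinfun_funpow_add blinfun_funpow_scaleR u0 h(2) scale_of_real using t(1) by simp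
    then have "dist (smul (of_real (inverse t)) ((blinfun_apply B ^^ p) (u + t *\<^sub>R h))) v < e"
      using e by (simp only: dist_self)
    ultimately show ?thesis
      unfolding moves_near_def by blast
  qed
  have gh0: "(blinfun_apply B ^^ (2 * p)) g = 0" "(blinfun_apply B ^^ (2 * p)) h = 0"
    by (simp_all add: mult_2 funpow_add g(2) h(2) u0 v0)
  let ?S = "blinfun_apply (id_blinfun + B)"
  have "\<exists>x. (\<forall>n. x n \<in> Z) \<and> x \<longlonglongrightarrow> u \<and> (\<lambda>n. (?S ^^ n) (x n)) \<longlonglongrightarrow> 0"
    using id_plus_nilpotent_orbits(2)[OF Z' Z(2) g(1) gh0(1) p] by (simp only: g(2))
  then obtain x where x: "\<And>n. x n \<in> Z" "x \<longlonglongrightarrow> u" "(\<lambda>n. (?S ^^ n) (x n)) \<longlonglongrightarrow> 0"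
    by iprover
  have "\<exists>y. (\<forall>n. y n \<in> Z) \<and> y \<longlonglongrightarrow> 0 \<and> (\<lambda>n. (?S ^^ n) (y n)) \<longlonglongrightarrow> v"
    using id_plus_nilpotent_orbits(1)[OF Z' Z(2) h(1) gh0(2) p] by (simp only: h(2))
  then obtain y where y: "\<And>n. y n \<in> Z" "y \<longlonglongrightarrow> 0" "(\<lambda>n. (?S ^^ n) (y n)) \<longlonglongrightarrow> v"
    by iprover
  have "(\<lambda>n. x n + y n) \<longlonglongrightarrow> u"
    using tendsto_add[OF x(2) y(2)] by simp
  then have near_u: "\<forall>\<^sub>F n in sequentially. dist (x n + y n) u < e"
    using e by (rule tendstoD)
  have "(\<lambda>n. (blinfun_apply (id_blinfun + B) ^^ n) (x n + y n)) \<longlonglongrightarrow> v"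
    unfolding blinfun_funpow_add using tendsto_add[OF x(3) y(3)] by simp
  then have near_v: "\<forall>\<^sub>F n in sequentially. dist ((blinfun_apply (id_blinfun + B) ^^ n) (x n + y n)) v < e"
    using e by (rule tendstoD)
  obtain n where "dist (x n + y n) u < e"
    and n: "dist ((blinfun_apply (id_blinfun + B) ^^ n) (x n + y n)) v < e"
    using eventually_happens'[OF sequentially_bot eventually_conj[OF near_u near_v]]
    by (elim exE conjE) (rule that)
  moreover have "x n + y n \<in> Z"
    using Z' x(1) y(1) by (intro real_vector.subspace_add)
  moreover have "dist (smul 1 ((blinfun_apply (id_blinfun + B) ^^ n) (x n + y n))) v < e"
    using n by (simp only: scale_one)
  ultimately show "moves_near smul {1} Z u v e (blinfun_apply (id_blinfun + B))"
    unfolding moves_near_def by blast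
qed

lemma closed_operators: "closed (operators smul)"
proof -
  have "closed {T. blinfun_apply T (smul c x) = smul c (blinfun_apply T x)}" for c x
    by (intro closed_Collect_eq continuous_intros bounded_bilinear.continuous_on[OF bounded_bilinear_scale])
  then show ?thesis
    unfolding operators_def by (simp add: closed_Collect_all)
qed

lemma nilpotent_closure_eq:
  "nilpotent_closure smul = closure {T \<in> operators smul. finite_rank smul T \<and> nilpotent T}"
proof -
  let ?F = "{T \<in> operators smul. finite_rank smul T \<and> nilpotent T}"
  have "closure ?F \<subseteq> operators smul"
    by (rule closure_minimal[OF _ closed_operators]) auto
  moreover have "operators smul \<inter> ?F = ?F" by auto
  ultimately show ?thesis
    unfolding nilpotent_closure_def closure_of_subtopology by (simp add: inf.absorb2)
qed

lemma nilpotent_closure_subset: "nilpotent_closure smul \<subseteq> operators smul"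
  unfolding nilpotent_closure_eq by (rule closure_minimal[OF _ closed_operators]) auto

lemma not_subset_line:
  assumes "infinite_dimensional smul"
  shows "\<not> UNIV \<subseteq> range (\<lambda>c. smul c m)"
proof
  assume "UNIV \<subseteq> range (\<lambda>c. smul c m)"
  then have "span {m} = UNIV"
    by (auto simp: span_singleton)
  then show False
    using assms unfolding infinite_dimensional_def by blast
qed

lemma dual_not_subset_line:
  assumes "infinite_dimensional smul"
  shows "\<not> dual smul \<subseteq> range (\<lambda>c. dual_scale c m)"
proof
  assume line: "dual smul \<subseteq> range (\<lambda>c. dual_scale c m)"
  obtain e and f :: "nat \<Rightarrow> 'a \<Rightarrow>\<^sub>L 'k"
    where *: "\<forall>i<2. (\<forall>g\<in>{}. blinfun_apply g (e i) = (0 :: 'k)) \<and> f i \<in> dual smul \<and>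
      (\<forall>b\<in>span {}. blinfun_apply (f i) b = 0)"
      and **: "\<forall>i<2. \<forall>j<2. blinfun_apply (f i) (e j) = (if i = j then 1 else 0)"
    using ex_biorthogonal[OF assms finite.emptyI empty_subsetI finite.emptyI, of 2] by blast
  have f: "f i \<in> dual smul" if "i < 2" for i
    using * that by blast
  have fe: "blinfun_apply (f i) (e j) = (if i = j then 1 else 0)" if "i < 2" "j < 2" for i j
    using ** that by blast
  obtain c where c: "f 0 = dual_scale c m"
    using line f[of 0] by auto
  obtain d where d: "f 1 = dual_scale d m"
    using line f[of 1] by auto
  have "c * blinfun_apply m (e 0) = 1" "c * blinfun_apply m (e 1) = 0"
    "d * blinfun_apply m (e 1) = 1"
    using fe[of 0 0] fe[of 0 1] fe[of 1 1] unfolding c d dual_scale_apply by simp_all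
  then show False by auto
qed

lemma dense_in_nilpotent_closure:
  assumes "\<And>T0 \<epsilon>. T0 \<in> operators smul \<Longrightarrow> finite_rank smul T0 \<Longrightarrow> nilpotent T0 \<Longrightarrow> 0 < \<epsilon> \<Longrightarrow>
      \<exists>T\<in>{T \<in> operators smul. finite_rank smul T \<and> nilpotent T}. dist T T0 < \<epsilon> \<and> P T"
  shows "nilpotent_closure smul \<subseteq> closure {T \<in> nilpotent_closure smul. P T}"
proof -
  let ?F = "{T \<in> operators smul. finite_rank smul T \<and> nilpotent T}"
  have "?F \<subseteq> closure {T \<in> nilpotent_closure smul. P T}"
  proof
    fix T0 assume T0: "T0 \<in> ?F"
    show "T0 \<in> closure {T \<in> nilpotent_closure smul. P T}"
      unfolding closure_approachable
    proof (intro allI impI)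
      fix \<epsilon> :: real assume "0 < \<epsilon>"
      with T0 assms[of T0 \<epsilon>] obtain T where T: "T \<in> ?F" "dist T T0 < \<epsilon>" "P T" by blast
      have "T \<in> nilpotent_closure smul"
        unfolding nilpotent_closure_eq by (rule subsetD[OF closure_subset T(1)])
      with T(3) have "T \<in> {T \<in> nilpotent_closure smul. P T}" by simp
      with T(2) show "\<exists>T\<in>{T \<in> nilpotent_closure smul. P T}. dist T T0 < \<epsilon>" by (rule bexI)
    qed
  qed
  then have "closure ?F \<subseteq> closure {T \<in> nilpotent_closure smul. P T}"
    by (rule closure_minimal) (rule closed_closure)
  then show ?thesis
    by (rule order_trans[OF eq_refl[OF nilpotent_closure_eq]])
qed

lemma residual_primal:
  assumes sep: "separable_space (euclidean :: 'a topology)" and inf: "infinite_dimensional smul"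
  shows "residual_in (nilpotent_closure smul)
      {T \<in> nilpotent_closure smul. supercyclic smul UNIV (blinfun_apply T)}" (is ?A)
    and "residual_in (nilpotent_closure smul)
      {T \<in> nilpotent_closure smul. hypercyclic UNIV (blinfun_apply (id_blinfun + T))}" (is ?B)
proof -
  let ?N = "nilpotent_closure smul"
  have sep': "separable_space (top_of_set (UNIV :: 'a set))" using sep by simp
  have hom: "blinfun_apply T (smul c z) = smul c (blinfun_apply T z)" if "T \<in> ?N" for T c z
    using that nilpotent_closure_subset by (auto simp: operators_def)
  have cont: "continuous_on ?N (\<lambda>T. T)" "continuous_on ?N (\<lambda>T. id_blinfun + T)"
    by (intro continuous_intros)+
  have near: "\<exists>T\<in>{T \<in> operators smul. finite_rank smul T \<and> nilpotent T}. dist T T0 < \<epsilon> \<and>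
      moves_near smul UNIV UNIV u v e (blinfun_apply T) \<and>
      moves_near smul {1} UNIV u v e (blinfun_apply (id_blinfun + T))"
    if T0: "T0 \<in> operators smul" "finite_rank smul T0" "nilpotent T0" "0 < \<epsilon>" and e: "0 < e"
    for T0 \<epsilon> u v e
  proof -
    obtain T where T: "T \<in> {T \<in> operators smul. finite_rank smul T \<and> nilpotent T}" "dist T T0 < \<epsilon>"
      "chains_to UNIV (blinfun_apply T) u v"
      using perturbation_chains_to[OF inf T0] by blast
    from chains_to_imp_moves_near[OF subspace_UNIV UNIV_I UNIV_I UNIV_I T(3) e] T(1,2)
    show ?thesis by blast
  qed
  have dense: "?N \<subseteq> closure {T \<in> ?N. moves_near smul UNIV UNIV u v e (blinfun_apply T)}"
    "?N \<subseteq> closure {T \<in> ?N. moves_near smul {1} UNIV u v e (blinfun_apply (id_blinfun + T))}"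
    if "0 < e" for u v e
    using near[OF _ _ _ _ that] by (intro dense_in_nilpotent_closure; meson)+
  have "residual_in ?N {T \<in> ?N. orbit_dense smul UNIV UNIV (blinfun_apply T)}"
    by (rule residual_orbit_dense[where A = "\<lambda>T. T", OF closed_UNIV subspace_UNIV not_subset_line[OF inf] sep' cont(1)])
       (simp_all add: hom dense)
  then show ?A
    by (simp only: supercyclic_iff_orbit_dense[OF subspace_UNIV UNIV_I])
  have "residual_in ?N {T \<in> ?N. orbit_dense smul {1} UNIV (blinfun_apply (id_blinfun + T))}"
    by (rule residual_orbit_dense[where A = "\<lambda>T. id_blinfun + T", OF closed_UNIV subspace_UNIV not_subset_line[OF inf] sep' cont(2)])
       (simp_all add: hom dense blinfun.add_left scale_right_distrib)
  then show ?B
    by (simp only: hypercyclic_iff_orbit_dense[OF UNIV_I])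
qed

lemma banach_space_over_dual_scale: "banach_space_over (dual_scale :: 'k \<Rightarrow> ('a \<Rightarrow>\<^sub>L 'k) \<Rightarrow> 'a \<Rightarrow>\<^sub>L 'k)"
proof
  show "norm (dual_scale c f) = norm c * norm f" for c :: 'k and f :: "'a \<Rightarrow>\<^sub>L 'k"
  proof (rule antisym)
    show le: "norm (dual_scale c f) \<le> norm c * norm f" for c :: 'k and f :: "'a \<Rightarrow>\<^sub>L 'k"
      by (rule norm_blinfun_bound)
         (auto simp: dual_scale_apply norm_mult mult.assoc intro!: mult_left_mono norm_blinfun)
    show "norm c * norm f \<le> norm (dual_scale c f)"
    proof (cases "c = 0")
      case False
      have "dual_scale (inverse c) (dual_scale c f) = f"
        by (rule blinfun_eqI) (simp add: dual_scale_apply False)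
      with le[of "inverse c" "dual_scale c f"] have "norm f \<le> inverse (norm c) * norm (dual_scale c f)"
        by (simp add: norm_inverse)
      then show ?thesis using False by (simp add: field_simps)
    qed simp
  qed
qed (auto intro!: blinfun_eqI simp: dual_scale_apply blinfun.add_left blinfun.add_right
    blinfun.scaleR_left distrib_left distrib_right scaleR_conv_of_real)

end

definition dual_operator :: "('a::banach \<Rightarrow>\<^sub>L 'a) \<Rightarrow> ('a \<Rightarrow>\<^sub>L 'k::real_or_complex) \<Rightarrow>\<^sub>L ('a \<Rightarrow>\<^sub>L 'k)" where
  "dual_operator = bounded_bilinear.prod_left (o\<^sub>L)"

lemma dual_operator_apply: "blinfun_apply (dual_operator T) = dual_map T"
  by (simp add: dual_operator_def dual_map_def fun_eq_iff
      bounded_bilinear.prod_left.rep_eq[OF bounded_bilinear_blinfun_compose])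

lemma continuous_on_dual_operator: "continuous_on N dual_operator"
  unfolding dual_operator_def
  by (intro linear_continuous_on bounded_bilinear.bounded_linear_prod_left[OF bounded_bilinear_blinfun_compose])

context banach_space_over
begin

lemma subspace_dual: "module.subspace dual_scale (dual smul)"
proof -
  interpret d: banach_space_over "dual_scale :: 'k \<Rightarrow> ('a \<Rightarrow>\<^sub>L 'k) \<Rightarrow> 'a \<Rightarrow>\<^sub>L 'k"
    by (rule banach_space_over_dual_scale)
  show ?thesis
    unfolding d.subspace_def
    by (auto simp: dual_add) (auto simp: dual_def dual_scale_apply)
qed

lemma closed_dual: "closed (dual smul)"
proof -
  have "closed {f :: 'a \<Rightarrow>\<^sub>L 'k. blinfun_apply f (smul c x) = c * blinfun_apply f x}" for c x
    by (intro closed_Collect_eq continuous_intros)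
  then show ?thesis
    unfolding dual_def by (simp add: closed_Collect_all)
qed

lemma dual_map_mem: "T \<in> operators smul \<Longrightarrow> f \<in> dual smul \<Longrightarrow> dual_map T f \<in> dual smul"
  by (simp add: dual_map_def dual_def operators_def)

lemma residual_dual:
  assumes sep: "separable_space (top_of_set (dual smul))" and inf: "infinite_dimensional smul"
  shows "residual_in (nilpotent_closure smul)
      {T \<in> nilpotent_closure smul. supercyclic dual_scale (dual smul) (dual_map T)}" (is ?A)
    and "residual_in (nilpotent_closure smul)
      {T \<in> nilpotent_closure smul. hypercyclic (dual smul) (\<lambda>f. f + dual_map T f)}" (is ?B)
proof -
  interpret d: banach_space_over "dual_scale :: 'k \<Rightarrow> ('a \<Rightarrow>\<^sub>L 'k) \<Rightarrow> 'a \<Rightarrow>\<^sub>L 'k"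
    by (rule banach_space_over_dual_scale)
  let ?N = "nilpotent_closure smul"
  let ?Z = "dual smul"
  have cont: "continuous_on ?N dual_operator" "continuous_on ?N (\<lambda>T. id_blinfun + dual_operator T)"
    by (intro continuous_intros continuous_on_dual_operator)+
  have mem: "dual_map T f \<in> ?Z" if "T \<in> ?N" "f \<in> ?Z" for T f
    using that nilpotent_closure_subset dual_map_mem by blast
  have hom: "dual_map T (dual_scale c f) = dual_scale c (dual_map T f)" for T and f :: "'a \<Rightarrow>\<^sub>L 'k" and c
    by (rule blinfun_eqI) (simp add: dual_map_def dual_scale_apply)
  have id_plus: "blinfun_apply (id_blinfun + dual_operator T) = (\<lambda>f. f + dual_map T f)"
    for T :: "'a \<Rightarrow>\<^sub>L 'a"
    by (simp add: fun_eq_iff blinfun.add_left dual_operator_apply)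
  have near: "\<exists>T\<in>{T \<in> operators smul. finite_rank smul T \<and> nilpotent T}. dist T T0 < \<epsilon> \<and>
      moves_near dual_scale UNIV ?Z u v e (blinfun_apply (dual_operator T)) \<and>
      moves_near dual_scale {1} ?Z u v e (blinfun_apply (id_blinfun + dual_operator T))"
    if T0: "T0 \<in> operators smul" "finite_rank smul T0" "nilpotent T0" "0 < \<epsilon>"
      and e: "0 < e" and uv: "u \<in> ?Z" "v \<in> ?Z" for T0 \<epsilon> u v e
  proof -
    obtain T where T: "T \<in> {T \<in> operators smul. finite_rank smul T \<and> nilpotent T}" "dist T T0 < \<epsilon>"
      "chains_to ?Z (blinfun_apply (dual_operator T)) u v"
      using perturbation_dual_chains_to[OF inf T0 uv] unfolding dual_operator_apply by blast
    have "blinfun_apply (dual_operator T) f \<in> ?Z" if "f \<in> ?Z" for f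
      using T(1) that by (simp add: dual_operator_apply dual_map_mem)
    from d.chains_to_imp_moves_near[OF subspace_dual this uv T(3) e] T(1,2) show ?thesis by blast
  qed
  have dense: "?N \<subseteq> closure {T \<in> ?N. moves_near dual_scale UNIV ?Z u v e (blinfun_apply (dual_operator T))}"
    "?N \<subseteq> closure {T \<in> ?N. moves_near dual_scale {1} ?Z u v e (blinfun_apply (id_blinfun + dual_operator T))}"
    if "u \<in> ?Z" "v \<in> ?Z" "0 < e" for u v e
    using near[OF _ _ _ _ that(3,1,2)] by (intro dense_in_nilpotent_closure; meson)+
  have "residual_in ?N {T \<in> ?N. orbit_dense dual_scale UNIV ?Z (blinfun_apply (dual_operator T))}"
    by (rule d.residual_orbit_dense[OF closed_dual subspace_dual dual_not_subset_line[OF inf] sep cont(1)])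
       (use dense in \<open>simp_all add: hom mem dual_operator_apply\<close>)
  moreover have "supercyclic dual_scale ?Z (dual_map T)
      \<longleftrightarrow> orbit_dense dual_scale UNIV ?Z (blinfun_apply (dual_operator T))" if "T \<in> ?N" for T
    unfolding dual_operator_apply
    by (rule d.supercyclic_iff_orbit_dense[OF subspace_dual]) (rule mem[OF that])
  ultimately show ?A by (simp cong: conj_cong)
  have "residual_in ?N {T \<in> ?N. orbit_dense dual_scale {1} ?Z (blinfun_apply (id_blinfun + dual_operator T))}"
    by (rule d.residual_orbit_dense[OF closed_dual subspace_dual dual_not_subset_line[OF inf] sep cont(2)])
       (use dense in \<open>simp_all add: hom mem id_plus dual_add d.scale_right_distrib\<close>)
  moreover have "hypercyclic ?Z (\<lambda>f. f + dual_map T f)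
      \<longleftrightarrow> orbit_dense dual_scale {1} ?Z (blinfun_apply (id_blinfun + dual_operator T))" if "T \<in> ?N" for T
    unfolding id_plus
    by (rule d.hypercyclic_iff_orbit_dense) (use mem[OF that] dual_add in blast)
  ultimately show ?B by (simp cong: conj_cong)
qed

end

theorem theorem1p19:
  fixes smul :: "'k::real_or_complex \<Rightarrow> 'a::banach \<Rightarrow> 'a"
    and N :: "('a \<Rightarrow>\<^sub>L 'a) set"
  assumes "banach_space_over smul"
    and "separable_space (euclidean :: 'a topology)"
    and "infinite_dimensional smul"
    and "N = nilpotent_closure smul"
  shows "complete N \<and>
    dense_gdelta_in (top_of_set N)
      {T \<in> N. supercyclic smul UNIV (blinfun_apply T) \<and>
              hypercyclic UNIV (blinfun_apply (id_blinfun + T))} \<and>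
    (separable_space (top_of_set (dual smul)) \<longrightarrow>
      dense_gdelta_in (top_of_set N)
        {T \<in> N. supercyclic smul UNIV (blinfun_apply T) \<and>
                supercyclic dual_scale (dual smul) (dual_map T) \<and>
                hypercyclic UNIV (blinfun_apply (id_blinfun + T)) \<and>
                hypercyclic (dual smul) (\<lambda>f. f + dual_map T f)})"
proof -
  interpret banach_space_over smul by fact
  have closed: "closed N"
    unfolding assms(4) nilpotent_closure_eq by simp
  note primal = residual_primal[OF assms(2,3), folded assms(4)]
  have "dense_gdelta_in (top_of_set N)
      {T \<in> N. supercyclic smul UNIV (blinfun_apply T) \<and> hypercyclic UNIV (blinfun_apply (id_blinfun + T))}"
    using residual_in_imp_dense_gdelta[OF closed residual_in_Int[OF primal]]
    by (simp add: Collect_conj_eq Int_ac)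
  moreover have "dense_gdelta_in (top_of_set N)
      {T \<in> N. supercyclic smul UNIV (blinfun_apply T) \<and>
              supercyclic dual_scale (dual smul) (dual_map T) \<and>
              hypercyclic UNIV (blinfun_apply (id_blinfun + T)) \<and>
              hypercyclic (dual smul) (\<lambda>f. f + dual_map T f)}"
    if "separable_space (top_of_set (dual smul))"
  proof -
    note dual = residual_dual[OF that assms(3), folded assms(4)]
    show ?thesis
      using residual_in_imp_dense_gdelta[OF closed
          residual_in_Int[OF residual_in_Int[OF primal] residual_in_Int[OF dual]]]
      by (simp add: Collect_conj_eq Int_ac)
  qed
  ultimately show ?thesis
    using closed by (simp add: complete_eq_closed)
qed

end
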